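(* Let $d\ge1$, $R>0$, $\alpha\in(0,1)$, $t_1>0$, $t_2,\dots,t_d\ge0$, $s_1,\dots,s_d>0$, and suppose $$b_l=\prod_{j=1}^d e^{-t_jl_j},\qquad a_l=\prod_{j=1}^d e^{s_jl_j},\qquad l\in\mathbb{N}_*^d,$$ where $\frac{t_1}{s_1}>\frac{t_j}{s_j}$ for all $j\in\{2,\dots,d\}$. Then the minimax separation rate $r^\star_\epsilon$ over $\Theta_{a,R}$ satisfies $$r_\epsilon^\star\sim\epsilon^{\frac{s_1}{s_1+t_1}}\quad\text{as }\epsilon\to0.$$
   Context: $\mathbb{N}_*=\{1,2,3,\dots\}$. For a noise level $\epsilon>0$ one observes $y=(y_l)_{l\in\mathbb{N}_*^d}$, $y_l=b_l\theta_l+\epsilon\xi_l$, where the $\xi_l$ are i.i.d. standard Gaussian, $b=(b_l)$ is a known sequence and $\theta\in\ell^2(\mathbb{N}_*^d)$ is unknown. $\mathbb{P}_\theta$ is the law of $y$; $\mathbb{P}_0$ corresponds to $\theta=0$. $\|\cdot\|$ is the $\ell^2$ norm. $\Theta_{a,R}=\{\theta\in\ell^2(\mathbb{N}_*^d):\sum_l a_l^2\theta_l^2\le R^2\}$ and $\Theta_{a,R}(r)=\{\theta\in\Theta_{a,R}:\|\theta\|\ge r\}$. All parameters other than $\epsilon$ are fixed. One tests $H_0:\theta=0$ against $\theta\in\Theta_{a,R}(r_\epsilon)$. A test $\psi$ is a measurable function of the data with values in $\{0,1\}$. A level-$\alpha$ test is a test function $\psi_\alpha$ (which may depend on $\epsilon$)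 satisfying $\mathbb{P}_0(\psi_\alpha=1)\le\alpha+o(1)$ as $\epsilon\to0$. $\beta_\epsilon(\Theta_{a,R}(r_\epsilon),\psi)=\sup_{\theta\in\Theta_{a,R}(r_\epsilon)}\mathbb{P}_\theta(\psi=0)$, and $\beta_\epsilon(\Theta_{a,R}(r_\epsilon),\alpha)=\inf_{\psi_\alpha}\beta_\epsilon(\Theta_{a,R}(r_\epsilon),\psi_\alpha)$, the infimum being over all level-$\alpha$ tests. A family $r^\star_\epsilon$ is a minimax separation rate over $\Theta_{a,R}$ if, as $\epsilon\to0$, $\beta_\epsilon(\Theta_{a,R}(r_\epsilon),\alpha)\to1-\alpha$ whenever $r_\epsilon/r_\epsilon^\star\to0$, and $\beta_\epsilon(\Theta_{a,R}(r_\epsilon),\alpha)\to0$ whenever $r_\epsilon/r_\epsilon^\star\to\infty$. $v_\epsilon\sim w_\epsilon$ as $\epsilon\to0$ means that there are two positive constants $k_0,k_1$ such that $k_0w_\epsilon\le v_\epsilon\le k_1w_\epsilon$ for all $\epsilon>0$.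
   Formalization: The relation ~ is asserted for all sufficiently small ε rather than for all ε>0 (rates are arbitrary away from 0), and the o(1) in the level is an arbitrary sequence fixed before the infimum over tests, since otherwise the infimum would be 0. *)

theory Defs
  imports "HOL-Probability.Probability"
begin

text \<open>
  Elements of \<open>multi_idx d\<close> are functions on \<open>nat\<close>, extensional outside \<open>{1..d}\<close>, so that they
  correspond one-to-one to the $d$-tuples of positive integers.
\<close>

definition multi_idx :: "nat \<Rightarrow> (nat \<Rightarrow> nat) set" where
  "multi_idx d = (\<Pi>\<^sub>E j\<in>{1..d}. {1..})"

definition l2 :: "'i set \<Rightarrow> ('i \<Rightarrow> real) set" where
  "l2 I = {\<theta>. (\<lambda>l. (\<theta> l)\<^sup>2) summable_on I}"

definition l2norm :: "'i set \<Rightarrow> ('i \<Rightarrow> real) \<Rightarrow> real" where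
  "l2norm I \<theta> = sqrt (\<Sum>\<^sub>\<infinity>l\<in>I. (\<theta> l)\<^sup>2)"

text \<open>
  Summability is required explicitly, because the infinite sum of a non-summable family is \<open>0\<close>
  by convention.
\<close>

definition ellipsoid :: "'i set \<Rightarrow> ('i \<Rightarrow> real) \<Rightarrow> real \<Rightarrow> ('i \<Rightarrow> real) set" where
  "ellipsoid I a R = {\<theta> \<in> l2 I. (\<lambda>l. (a l)\<^sup>2 * (\<theta> l)\<^sup>2) summable_on I \<and>
     (\<Sum>\<^sub>\<infinity>l\<in>I. (a l)\<^sup>2 * (\<theta> l)\<^sup>2) \<le> R\<^sup>2}"

definition ellipsoid_away :: "'i set \<Rightarrow> ('i \<Rightarrow> real) \<Rightarrow> real \<Rightarrow> real \<Rightarrow> ('i \<Rightarrow> real) set" where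
  "ellipsoid_away I a R r = {\<theta> \<in> ellipsoid I a R. l2norm I \<theta> \<ge> r}"

definition obs_space :: "'i set \<Rightarrow> ('i \<Rightarrow> real) measure" where
  "obs_space I = (\<Pi>\<^sub>M l\<in>I. borel)"

definition white_noise :: "'i set \<Rightarrow> ('i \<Rightarrow> real) measure" where
  "white_noise I = (\<Pi>\<^sub>M l\<in>I. density lborel (\<lambda>x. ennreal (std_normal_density x)))"

definition obs_law :: "'i set \<Rightarrow> ('i \<Rightarrow> real) \<Rightarrow> real \<Rightarrow> ('i \<Rightarrow> real) \<Rightarrow> ('i \<Rightarrow> real) measure" where
  "obs_law I b \<epsilon> \<theta> = distr (white_noise I) (obs_space I) (\<lambda>\<xi>. \<lambda>l\<in>I. b l * \<theta> l + \<epsilon> * \<xi> l)"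

definition tests :: "'i set \<Rightarrow> (('i \<Rightarrow> real) \<Rightarrow> nat) set" where
  "tests I = obs_space I \<rightarrow>\<^sub>M count_space {0, 1}"

definition level_tests ::
    "'i set \<Rightarrow> ('i \<Rightarrow> real) \<Rightarrow> real \<Rightarrow> real \<Rightarrow> (('i \<Rightarrow> real) \<Rightarrow> nat) set" where
  "level_tests I b \<epsilon> c =
     {\<psi> \<in> tests I. measure (obs_law I b \<epsilon> (\<lambda>_. 0)) {y \<in> space (obs_space I). \<psi> y = 1} \<le> c}"

text \<open>
  Type II errors take values in \<open>ennreal\<close>, so that the supremum over an empty set of alternatives
  (which occurs for large radii) is \<open>0\<close>.
\<close>

definition type2_error ::
    "'i set \<Rightarrow> ('i \<Rightarrow> real) \<Rightarrow> real \<Rightarrow> ('i \<Rightarrow> real) set \<Rightarrow> (('i \<Rightarrow> real) \<Rightarrow> nat) \<Rightarrow> ennreal" where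
  "type2_error I b \<epsilon> \<Theta> \<psi> =
     (SUP \<theta>\<in>\<Theta>. emeasure (obs_law I b \<epsilon> \<theta>) {y \<in> space (obs_space I). \<psi> y = 0})"

definition minimax_type2_error ::
    "'i set \<Rightarrow> ('i \<Rightarrow> real) \<Rightarrow> real \<Rightarrow> ('i \<Rightarrow> real) set \<Rightarrow> real \<Rightarrow> ennreal" where
  "minimax_type2_error I b \<epsilon> \<Theta> c = (INF \<psi>\<in>level_tests I b \<epsilon> c. type2_error I b \<epsilon> \<Theta> \<psi>)"

text \<open>
  The level condition reads $P_0(\psi = 1) \le \alpha + \delta_\epsilon$, where \<open>\<delta>\<close> is the
  $o(1)$ term of the asymptotic level. It is a parameter fixed before the infimum over tests is
  taken: if \<open>\<delta>\<close> could depend on the test, then at each single \<open>\<epsilon>\<close> every test would belong to some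
  family of asymptotic level \<open>\<alpha>\<close>, and the infimum would be \<open>0\<close>, attained by \<open>\<psi> = 1\<close>.
  The choice \<open>\<delta> = 0\<close> gives exact level \<open>\<alpha>\<close>.
\<close>

definition minimax_separation_rate ::
    "'i set \<Rightarrow> ('i \<Rightarrow> real) \<Rightarrow> ('i \<Rightarrow> real) \<Rightarrow> real \<Rightarrow> real \<Rightarrow> (real \<Rightarrow> real) \<Rightarrow> (real \<Rightarrow> real) \<Rightarrow> bool" where
  "minimax_separation_rate I b a R \<alpha> \<delta> rstar \<longleftrightarrow>
     (\<forall>\<epsilon>>0. rstar \<epsilon> > 0) \<and>
     (\<forall>r. (\<forall>\<epsilon>>0. r \<epsilon> > 0) \<longrightarrow>
        (((\<lambda>\<epsilon>. r \<epsilon> / rstar \<epsilon>) \<longlongrightarrow> 0) (at_right 0) \<longrightarrow>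
          ((\<lambda>\<epsilon>. minimax_type2_error I b \<epsilon> (ellipsoid_away I a R (r \<epsilon>)) (\<alpha> + \<delta> \<epsilon>))
             \<longlongrightarrow> ennreal (1 - \<alpha>)) (at_right 0)) \<and>
        (filterlim (\<lambda>\<epsilon>. r \<epsilon> / rstar \<epsilon>) at_top (at_right 0) \<longrightarrow>
          ((\<lambda>\<epsilon>. minimax_type2_error I b \<epsilon> (ellipsoid_away I a R (r \<epsilon>)) (\<alpha> + \<delta> \<epsilon>))
             \<longlongrightarrow> 0) (at_right 0)))"

text \<open>
  Comparison is for all sufficiently small \<open>\<epsilon>\<close>: a separation rate is determined only by its
  behaviour as \<open>\<epsilon>\<close> tends to \<open>0\<close>, so no comparison valid for every \<open>\<epsilon> > 0\<close> can hold for all rates.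
\<close>

definition asymp_comparable :: "(real \<Rightarrow> real) \<Rightarrow> (real \<Rightarrow> real) \<Rightarrow> bool" where
  "asymp_comparable v w \<longleftrightarrow>
     (\<exists>k0>0. \<exists>k1>0. \<forall>\<^sub>F \<epsilon> in at_right 0. k0 * w \<epsilon> \<le> v \<epsilon> \<and> v \<epsilon> \<le> k1 * w \<epsilon>)"

end

theory Submission
  imports Defs
begin

text \<open>
  Put \<open>\<kappa> = t\<^sub>1 / s\<^sub>1\<close>, so that the claimed rate \<open>\<rho>\<close> satisfies \<open>\<rho>\<^sup>1\<^sup>+\<^sup>\<kappa> = \<epsilon>\<close>.

  If \<open>r / \<rho> \<rightarrow> 0\<close>, take a single spike of height \<open>r\<close> on the first axis, as far out as the ellipsoid allows
  (\<open>a\<^sub>l\<close> of order \<open>R / r\<close>). There \<open>b\<^sub>l\<close> is of order \<open>r\<^sup>\<kappa>\<close>, so the signal-to-noise ratio is of order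
  \<open>r\<^sup>1\<^sup>+\<^sup>\<kappa> / \<epsilon> = (r / \<rho>)\<^sup>1\<^sup>+\<^sup>\<kappa>\<close>; it vanishes, and the spike cannot be told from \<open>0\<close>.

  If \<open>r / \<rho> \<rightarrow> \<infinity>\<close>, the coordinates with \<open>a\<^sub>l \<le> M = 2 R / r\<close> carry at least half of the energy
  \<open>\<parallel>\<theta>\<parallel>\<^sup>2\<close>, and the noise in the naive estimates \<open>y\<^sub>l / b\<^sub>l\<close> over these coordinates has total
  variance \<open>\<epsilon>\<^sup>2 \<Sum> b\<^sub>l\<^sup>-\<^sup>2\<close>. Since the first axis strictly dominates, this sum is of the one-dimensional
  order \<open>M\<^sup>2\<^sup>\<kappa>\<close>, so the variance is negligible compared with \<open>r\<^sup>2\<close>.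
\<close>

section \<open>The standard Gaussian: second moment, shifts, quantiles\<close>

abbreviation gauss :: "real measure" where
  "gauss \<equiv> density lborel (\<lambda>x. ennreal (std_normal_density x))"

lemma prob_space_gauss: "prob_space gauss"
  by (rule prob_space_normal_density) simp

lemma nn_integral_gauss_square: "(\<integral>\<^sup>+x. ennreal (x\<^sup>2) \<partial>gauss) = 1"
proof -
  have "has_bochner_integral lborel (\<lambda>x. std_normal_density x * x\<^sup>2) 1"
    using std_normal_moment_even[of 1] by simp
  then have "(\<integral>\<^sup>+x. ennreal (std_normal_density x * x\<^sup>2) \<partial>lborel) = ennreal 1"
    by (intro nn_integral_eq_integral[THEN trans]) (auto simp: has_bochner_integral_iff)
  then show ?thesis
    by (simp add: nn_integral_density ennreal_mult')
qed

text \<open>The shifted density is the original one times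
  \<open>exp (x * h - h\<^sup>2 / 2) \<ge> 1 + x * h - h\<^sup>2 / 2\<close>, so it falls short of
  the original by at most a fraction whose Gaussian mean is small. The error term vanishes with
  \<open>h\<close>, as the undetectable case requires.\<close>

lemma emeasure_gauss_shift_le:
  assumes [measurable]: "B \<in> sets borel"
  shows "emeasure gauss B \<le> emeasure gauss {x. x + h \<in> B} + ennreal (h\<^sup>2 / 2 + \<bar>h\<bar>)"
proof -
  let ?\<phi> = std_normal_density
  interpret prob_space gauss by (rule prob_space_gauss)
  have [measurable]: "{x. x + h \<in> B} \<in> sets borel" by measurable
  have pw: "?\<phi> x \<le> ?\<phi> (x - h) + ?\<phi> x * (h\<^sup>2 / 2 + \<bar>h\<bar> / 2 + \<bar>h\<bar> / 2 * x\<^sup>2)" for x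
  proof -
    have "?\<phi> (x - h) = ?\<phi> x * exp (x * h - h\<^sup>2 / 2)"
      by (simp add: std_normal_density_def exp_add[symmetric] power2_eq_square field_simps)
    \<comment> \<open>The bound \<open>\<bar>x\<bar> \<le> (1 + x\<^sup>2) / 2\<close> leaves an
      error that integrates by means of the unit second moment.\<close>
    moreover have "\<bar>x * h\<bar> \<le> \<bar>h\<bar> / 2 + \<bar>h\<bar> / 2 * x\<^sup>2"
    proof -
      have "2 * \<bar>x\<bar> \<le> 1 + x\<^sup>2" using sum_squares_bound[of "\<bar>x\<bar>" 1] by simp
      then have "\<bar>h\<bar> * (2 * \<bar>x\<bar>) \<le> \<bar>h\<bar> * (1 + x\<^sup>2)" by (rule mult_left_mono) simp
      then show ?thesis by (simp add: abs_mult algebra_simps)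
    qed
    then have "1 \<le> exp (x * h - h\<^sup>2 / 2) + (h\<^sup>2 / 2 + \<bar>h\<bar> / 2 + \<bar>h\<bar> / 2 * x\<^sup>2)"
      using exp_ge_add_one_self[of "x * h - h\<^sup>2 / 2"] by linarith
    from mult_left_mono[OF this, of "?\<phi> x"] show ?thesis
      using calculation by (simp add: algebra_simps)
  qed
  have "emeasure gauss B = (\<integral>\<^sup>+x. ennreal (?\<phi> x) * indicator B x \<partial>lborel)"
    by (simp add: emeasure_density)
  also have "\<dots> \<le> (\<integral>\<^sup>+x. ennreal (?\<phi> (x - h)) * indicator B x
      + ennreal (?\<phi> x) * ennreal (h\<^sup>2 / 2 + \<bar>h\<bar> / 2 + \<bar>h\<bar> / 2 * x\<^sup>2) \<partial>lborel)"
    using pw by (intro nn_integral_mono)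
      (auto simp: indicator_def ennreal_mult''[symmetric] ennreal_plus[symmetric]
        intro!: ennreal_leI simp del: ennreal_plus)
  also have "\<dots> = (\<integral>\<^sup>+x. ennreal (?\<phi> (x - h)) * indicator B x \<partial>lborel)
      + (\<integral>\<^sup>+x. ennreal (h\<^sup>2 / 2 + \<bar>h\<bar> / 2 + \<bar>h\<bar> / 2 * x\<^sup>2) \<partial>gauss)"
    by (subst nn_integral_add) (auto simp: nn_integral_density simp del: ennreal_plus)
  also have "(\<integral>\<^sup>+x. ennreal (?\<phi> (x - h)) * indicator B x \<partial>lborel) = emeasure gauss {x. x + h \<in> B}"
    by (subst nn_integral_real_affine[of _ 1 h])
      (auto simp: emeasure_density indicator_def add.commute intro!: nn_integral_cong)
  also have "(\<integral>\<^sup>+x. ennreal (h\<^sup>2 / 2 + \<bar>h\<bar> / 2 + \<bar>h\<bar> / 2 * x\<^sup>2) \<partial>gauss)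
      = (\<integral>\<^sup>+x. ennreal (h\<^sup>2 / 2 + \<bar>h\<bar> / 2) + ennreal (\<bar>h\<bar> / 2) * ennreal (x\<^sup>2) \<partial>gauss)"
    by (intro nn_integral_cong) (simp add: ennreal_mult''[symmetric] ennreal_plus[symmetric] del: ennreal_plus)
  also have "\<dots> = ennreal (h\<^sup>2 / 2 + \<bar>h\<bar> / 2) + ennreal (\<bar>h\<bar> / 2)"
    by (simp add: nn_integral_add nn_integral_cmult nn_integral_gauss_square emeasure_space_1[simplified] del: ennreal_plus)
  also have "\<dots> = ennreal (h\<^sup>2 / 2 + \<bar>h\<bar>)"
    by (simp add: ennreal_plus[symmetric] del: ennreal_plus)
  finally show ?thesis .
qed

text \<open>A Gaussian has no atoms, so its distribution function is continuous and the intermediate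
  value theorem applies. An exact quantile lets a nonrandomized test attain a prescribed
  level.\<close>

lemma gauss_quantile:
  assumes "0 < p" "p < 1"
  obtains q where "measure gauss {..q} = p"
proof -
  interpret real_distribution gauss
    unfolding real_distribution_def real_distribution_axioms_def
    using prob_space_gauss by simp
  have cont: "isCont (cdf gauss) x" for x
  proof -
    have "AE y in lborel. y \<in> {x} \<longrightarrow> ennreal (std_normal_density y) = 0"
      by (rule eventually_mono[OF AE_lborel_singleton[of x]]) simp
    moreover have "{x} \<in> sets lborel" by simp
    ultimately have "{x} \<in> null_sets gauss"
      using null_sets_density_iff[of "\<lambda>y. ennreal (std_normal_density y)" lborel "{x}"] by simp
    then show ?thesis by (simp add: isCont_cdf measure_eq_0_null_sets)
  qed
  have "eventually (\<lambda>x. cdf gauss x < p) at_bot" "eventually (\<lambda>x. p < cdf gauss x) at_top"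
    using cdf_lim_at_bot cdf_lim_at_top_prob assms by (auto simp: order_tendsto_iff)
  then obtain u v where u: "cdf gauss u < p" and v: "p < cdf gauss v"
    by (auto simp: eventually_at_bot_linorder eventually_at_top_linorder)
  then have "u \<le> v" using cdf_nondecreasing[of v u] by linarith
  with u v cont obtain q where "cdf gauss q = p"
    using IVT[of "cdf gauss" u p v] by auto
  with that show ?thesis by (auto simp: cdf_def2)
qed

section \<open>White noise and the law of the observations\<close>

lemma prob_space_white_noise: "prob_space (white_noise I)"
  unfolding white_noise_def by (intro prob_space_PiM prob_space_gauss)

lemma sets_white_noise [measurable_cong]: "sets (white_noise I) = sets (obs_space I)"
  unfolding white_noise_def obs_space_def by (intro sets_PiM_cong) auto

lemma measurable_obs_component [measurable]: "l \<in> I \<Longrightarrow> (\<lambda>y. y l) \<in> obs_space I \<rightarrow>\<^sub>M borel"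
  unfolding obs_space_def by measurable

lemma measurable_white_noise_component:
  assumes "l \<in> I" shows "(\<lambda>\<xi>. \<xi> l) \<in> borel_measurable (white_noise I)"
  unfolding measurable_cong_sets[OF sets_white_noise refl] by (rule measurable_obs_component[OF assms])

lemma measurable_white_noise_gauss:
  assumes "l \<in> I" shows "(\<lambda>\<xi>. \<xi> l) \<in> white_noise I \<rightarrow>\<^sub>M gauss"
proof -
  have "sets gauss = sets borel" by simp
  from measurable_white_noise_component[OF assms] show ?thesis
    unfolding measurable_cong_sets[OF refl \<open>sets gauss = sets borel\<close>] .
qed

lemma measurable_obs_map:
  "(\<lambda>\<xi>. \<lambda>l\<in>I. b l * \<theta> l + \<epsilon> * \<xi> l) \<in> white_noise I \<rightarrow>\<^sub>M obs_space I"
  unfolding measurable_cong_sets[OF sets_white_noise refl] obs_space_def by measurable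

lemma emeasure_obs_law:
  assumes "A \<in> sets (obs_space I)"
  shows "emeasure (obs_law I b \<epsilon> \<theta>) A =
    emeasure (white_noise I) {\<xi> \<in> space (white_noise I). (\<lambda>l\<in>I. b l * \<theta> l + \<epsilon> * \<xi> l) \<in> A}"
  unfolding obs_law_def emeasure_distr[OF measurable_obs_map assms]
  by (rule arg_cong2[where f=emeasure]) auto

lemma prob_space_obs_law: "prob_space (obs_law I b \<epsilon> \<theta>)"
  unfolding obs_law_def
  by (rule prob_space.prob_space_distr[OF prob_space_white_noise measurable_obs_map])

lemma distr_white_noise_component:
  assumes "l \<in> I" shows "distr (white_noise I) gauss (\<lambda>\<xi>. \<xi> l) = gauss"
  unfolding white_noise_def by (rule distr_PiM_component[OF prob_space_gauss assms])

lemma emeasure_white_noise_component: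
  assumes "l \<in> I" "B \<in> sets borel"
  shows "emeasure (white_noise I) {\<xi> \<in> space (white_noise I). \<xi> l \<in> B} = emeasure gauss B"
proof -
  have "emeasure gauss B = emeasure (distr (white_noise I) gauss (\<lambda>\<xi>. \<xi> l)) B"
    by (simp only: distr_white_noise_component[OF assms(1)])
  also have "\<dots> = emeasure (white_noise I) ((\<lambda>\<xi>. \<xi> l) -` B \<inter> space (white_noise I))"
    by (rule emeasure_distr[OF measurable_white_noise_gauss[OF assms(1)]]) (simp add: assms(2))
  also have "(\<lambda>\<xi>. \<xi> l) -` B \<inter> space (white_noise I) = {\<xi> \<in> space (white_noise I). \<xi> l \<in> B}"
    by blast
  finally show ?thesis by simp
qed

lemma nn_integral_white_noise_component_square:
  assumes "l \<in> I"
  shows "(\<integral>\<^sup>+\<xi>. ennreal ((\<xi> l)\<^sup>2) \<partial>white_noise I) = 1"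
proof -
  have "1 = (\<integral>\<^sup>+x. ennreal (x\<^sup>2) \<partial>distr (white_noise I) gauss (\<lambda>\<xi>. \<xi> l))"
    by (simp only: distr_white_noise_component[OF assms] nn_integral_gauss_square)
  also have "\<dots> = (\<integral>\<^sup>+\<xi>. ennreal ((\<xi> l)\<^sup>2) \<partial>white_noise I)"
    by (rule nn_integral_distr[OF measurable_white_noise_gauss[OF assms]]) simp
  finally show ?thesis by simp
qed

text \<open>Fubini: gluing coordinate \<open>i\<close> to the remaining ones presents the noise as
  the image of the product of \<open>gauss\<close> with the noise on \<open>I - {i}\<close>. The
  one-dimensional shift bound applies to each section, and its additive error is unchanged by
  integration because the remaining noise has total mass 1.\<close>

lemma emeasure_white_noise_shift_le:
  assumes i: "i \<in> I" and A: "A \<in> sets (obs_space I)"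
  shows "emeasure (white_noise I) A \<le>
    emeasure (white_noise I) {\<xi> \<in> space (white_noise I). \<xi>(i := \<xi> i + h) \<in> A} + ennreal (h\<^sup>2 / 2 + \<bar>h\<bar>)"
proof -
  let ?J = "I - {i}" and ?N = "white_noise I"
  let ?P = "gauss \<Otimes>\<^sub>M white_noise ?J"
  let ?g = "\<lambda>(x::real, X). X(i := x)"
  let ?A' = "{\<xi> \<in> space ?N. \<xi>(i := \<xi> i + h) \<in> A}"
  interpret G: prob_space gauss by (rule prob_space_gauss)
  interpret W: prob_space "white_noise ?J" by (rule prob_space_white_noise)
  interpret pair_sigma_finite gauss "white_noise ?J" ..
  have I: "insert i ?J = I" using i by auto
  have eq: "distr ?P ?N ?g = ?N"
    using distr_pair_PiM_eq_PiM[of ?J "\<lambda>_. gauss" i, OF prob_space_gauss prob_space_gauss]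
    unfolding white_noise_def I .
  have g: "?g \<in> ?P \<rightarrow>\<^sub>M ?N"
    using measurable_fun_upd[of I ?J i snd ?P "\<lambda>_. gauss" fst] I
    by (simp add: white_noise_def case_prod_beta')
  have "(\<lambda>\<xi>. \<xi>(i := \<xi> i + h)) \<in> ?N \<rightarrow>\<^sub>M ?N"
    unfolding white_noise_def using i measurable_component_singleton[of i I "\<lambda>_. gauss"]
    by (intro measurable_fun_upd[of I I i]) (auto intro!: borel_measurable_add)
  moreover have A1: "A \<in> sets ?N" using A by (simp add: sets_white_noise)
  ultimately have A2: "?A' \<in> sets ?N"
    by (auto dest!: measurable_sets simp: vimage_def Int_def conj_commute)
  have split: "emeasure ?N B = (\<integral>\<^sup>+X. emeasure gauss {x. X(i := x) \<in> B} \<partial>white_noise ?J)"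
    if B: "B \<in> sets ?N" for B
  proof -
    have "emeasure ?N B = emeasure (distr ?P ?N ?g) B" using eq by simp
    also have "\<dots> = emeasure ?P (?g -` B \<inter> space ?P)"
      by (rule emeasure_distr[OF g B])
    also have "\<dots> = (\<integral>\<^sup>+X. emeasure gauss ((\<lambda>x. (x, X)) -` (?g -` B \<inter> space ?P)) \<partial>white_noise ?J)"
      by (rule emeasure_pair_measure_alt2[OF measurable_sets[OF g B]])
    also have "\<dots> = (\<integral>\<^sup>+X. emeasure gauss {x. X(i := x) \<in> B} \<partial>white_noise ?J)"
      by (intro nn_integral_cong arg_cong2[where f=emeasure]) (auto simp: space_pair_measure)
    finally show ?thesis .
  qed
  have sect: "{x. X(i := x) \<in> B} \<in> sets borel"
    if B: "B \<in> sets ?N" and X: "X \<in> space (white_noise ?J)" for B X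
  proof -
    have "(\<lambda>x. (x, X)) -` (?g -` B \<inter> space ?P) \<in> sets gauss"
      by (rule sets_Pair2[OF measurable_sets[OF g B]])
    also have "(\<lambda>x. (x, X)) -` (?g -` B \<inter> space ?P) = {x. X(i := x) \<in> B}"
      using X by (auto simp: space_pair_measure)
    finally show ?thesis by simp
  qed
  have "emeasure ?N A = (\<integral>\<^sup>+X. emeasure gauss {x. X(i := x) \<in> A} \<partial>white_noise ?J)"
    by (rule split) fact
  also have "\<dots> \<le> (\<integral>\<^sup>+X. emeasure gauss {x. X(i := x) \<in> ?A'} + ennreal (h\<^sup>2 / 2 + \<bar>h\<bar>) \<partial>white_noise ?J)"
  proof (rule nn_integral_mono)
    fix X assume X: "X \<in> space (white_noise ?J)"
    have "emeasure gauss {x. X(i := x) \<in> A} \<le>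
      emeasure gauss {x. x + h \<in> {x. X(i := x) \<in> A}} + ennreal (h\<^sup>2 / 2 + \<bar>h\<bar>)"
      by (rule emeasure_gauss_shift_le[OF sect[OF A1 X]])
    also have "{x. x + h \<in> {x. X(i := x) \<in> A}} = {x. X(i := x) \<in> ?A'}"
    proof -
      \<comment> \<open>\<open>?A'\<close> also demands membership in the space of the noise; the
        gluing map supplies it, so that the two sections agree.\<close>
      have "X(i := x) \<in> space ?N" for x
        using measurable_space[OF g, of "(x, X)"] X by (auto simp: space_pair_measure)
      then show ?thesis by auto
    qed
    finally show "emeasure gauss {x. X(i := x) \<in> A} \<le>
      emeasure gauss {x. X(i := x) \<in> ?A'} + ennreal (h\<^sup>2 / 2 + \<bar>h\<bar>)" .
  qed
  also have "\<dots> = (\<integral>\<^sup>+X. emeasure gauss {x. X(i := x) \<in> ?A'} \<partial>white_noise ?J) + ennreal (h\<^sup>2 / 2 + \<bar>h\<bar>)"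
  proof -
    have "(\<lambda>X. emeasure gauss ((\<lambda>x. (x, X)) -` (?g -` ?A' \<inter> space ?P))) \<in> borel_measurable (white_noise ?J)"
      by (rule measurable_emeasure_Pair2[OF measurable_sets[OF g A2]])
    then have "(\<lambda>X. emeasure gauss {x. X(i := x) \<in> ?A'}) \<in> borel_measurable (white_noise ?J)"
      by (rule measurable_cong[THEN iffD1, rotated])
        (auto simp: space_pair_measure intro!: arg_cong2[where f=emeasure])
    then show ?thesis by (subst nn_integral_add) (auto simp: W.emeasure_space_1)
  qed
  also have "(\<integral>\<^sup>+X. emeasure gauss {x. X(i := x) \<in> ?A'} \<partial>white_noise ?J) = emeasure ?N ?A'"
    by (rule split[symmetric]) fact
  finally show ?thesis .
qed

section \<open>Tests: lower and upper bounds on the minimax error\<close>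

lemma sets_test_eq:
  assumes "\<psi> \<in> tests I" shows "{y \<in> space (obs_space I). \<psi> y = n} \<in> sets (obs_space I)"
proof -
  \<comment> \<open>For \<open>n\<close> outside \<open>{0, 1}\<close> the event is empty; the
    intersection keeps the preimage that of a set in the count space.\<close>
  have "{y \<in> space (obs_space I). \<psi> y = n} = \<psi> -` ({n} \<inter> {0, 1}) \<inter> space (obs_space I)"
    using measurable_space[of \<psi> "obs_space I" "count_space {0, 1}"] assms
    by (auto simp: tests_def)
  also have "\<dots> \<in> sets (obs_space I)"
    using assms unfolding tests_def by (rule measurable_sets) auto
  finally show ?thesis .
qed

lemma restrict_in_obs_space: "restrict y I \<in> space (obs_space I)"
  by (auto simp: obs_space_def space_PiM)

lemma emeasure_obs_law_test:
  assumes "\<psi> \<in> tests I"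
  shows "emeasure (obs_law I b \<epsilon> \<theta>) {y \<in> space (obs_space I). \<psi> y = n} =
    emeasure (white_noise I) {\<xi> \<in> space (white_noise I). \<psi> (\<lambda>l\<in>I. b l * \<theta> l + \<epsilon> * \<xi> l) = n}"
  using assms by (subst emeasure_obs_law) (simp_all add: restrict_in_obs_space sets_test_eq)

lemma measure_obs_law_test_0:
  assumes "\<psi> \<in> tests I"
  shows "measure (obs_law I b \<epsilon> \<theta>) {y \<in> space (obs_space I). \<psi> y = 0}
    = 1 - measure (obs_law I b \<epsilon> \<theta>) {y \<in> space (obs_space I). \<psi> y = 1}"
proof -
  interpret prob_space "obs_law I b \<epsilon> \<theta>" by (rule prob_space_obs_law)
  have sp: "space (obs_law I b \<epsilon> \<theta>) = space (obs_space I)"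
    "sets (obs_law I b \<epsilon> \<theta>) = sets (obs_space I)" by (auto simp: obs_law_def)
  have "{y \<in> space (obs_space I). \<psi> y = 0} = space (obs_law I b \<epsilon> \<theta>) - {y \<in> space (obs_space I). \<psi> y = 1}"
    using measurable_space[of \<psi> "obs_space I" "count_space {0, 1}"] assms
    by (auto simp: tests_def sp)
  then show ?thesis
    using prob_compl[unfolded sp, OF sets_test_eq[OF assms, of 1]] by (simp add: sp)
qed

text \<open>\<open>h\<close> is the signal-to-noise ratio of the spike. The spike acts on the data
  like a shift of the single noise coordinate \<open>i\<close> by \<open>h\<close>, so the test
  accepts almost as often as under the null hypothesis, where its level forces acceptance with
  probability at least \<open>1 - c\<close>.\<close>

lemma spike_type2_error_ge:
  fixes z :: real
  assumes i: "i \<in> I" and "\<epsilon> > 0" and \<psi>: "\<psi> \<in> level_tests I b \<epsilon> c"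
  defines "h \<equiv> b i * z / \<epsilon>"
  shows "ennreal (1 - c - (h\<^sup>2 / 2 + \<bar>h\<bar>)) \<le>
    emeasure (obs_law I b \<epsilon> (\<lambda>l. if l = i then z else 0)) {y \<in> space (obs_space I). \<psi> y = 0}"
proof -
  let ?\<theta> = "\<lambda>l. if l = i then z else 0"
  let ?N = "white_noise I" and ?A = "{y \<in> space (obs_space I). \<psi> y = 0}"
  let ?B = "{\<xi> \<in> space ?N. \<psi> (\<lambda>l\<in>I. b l * 0 + \<epsilon> * \<xi> l) = 0}"
  interpret P0: prob_space "obs_law I b \<epsilon> (\<lambda>_. 0)" by (rule prob_space_obs_law)
  interpret P1: prob_space "obs_law I b \<epsilon> ?\<theta>" by (rule prob_space_obs_law)
  have t: "\<psi> \<in> tests I" using \<psi> by (simp add: level_tests_def)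
  have event: "{\<xi> \<in> space ?N. \<psi> (\<lambda>l\<in>I. b l * \<theta> l + \<epsilon> * \<xi> l) = 0} \<in> sets (obs_space I)" for \<theta>
  proof -
    have "{\<xi> \<in> space ?N. \<psi> (\<lambda>l\<in>I. b l * \<theta> l + \<epsilon> * \<xi> l) = 0} =
      (\<lambda>\<xi>. \<lambda>l\<in>I. b l * \<theta> l + \<epsilon> * \<xi> l) -` ?A \<inter> space ?N"
      by (auto simp: restrict_in_obs_space)
    also have "\<dots> \<in> sets (obs_space I)"
      using measurable_sets[OF measurable_obs_map sets_test_eq[OF t]] by (simp only: sets_white_noise)
    finally show ?thesis .
  qed
  \<comment> \<open>Since \<open>\<epsilon> * h = b i * z\<close>, shifted noise without signal
    yields the same data as the spike with unshifted noise.\<close>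
  have "(\<lambda>l\<in>I. b l * 0 + \<epsilon> * (\<xi>(i := \<xi> i + h)) l) = (\<lambda>l\<in>I. b l * ?\<theta> l + \<epsilon> * \<xi> l)" for \<xi>
    using \<open>\<epsilon> > 0\<close> by (auto simp: fun_eq_iff h_def field_simps)
  then have "{\<xi> \<in> space ?N. \<xi>(i := \<xi> i + h) \<in> ?B} \<subseteq>
      {\<xi> \<in> space ?N. \<psi> (\<lambda>l\<in>I. b l * ?\<theta> l + \<epsilon> * \<xi> l) = 0}"
    by auto
  moreover have "{\<xi> \<in> space ?N. \<psi> (\<lambda>l\<in>I. b l * ?\<theta> l + \<epsilon> * \<xi> l) = 0} \<in> sets ?N"
    unfolding sets_white_noise by (rule event)
  ultimately have "emeasure ?N {\<xi> \<in> space ?N. \<xi>(i := \<xi> i + h) \<in> ?B} \<le> emeasure (obs_law I b \<epsilon> ?\<theta>) ?A"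
    unfolding emeasure_obs_law_test[OF t] by (rule emeasure_mono)
  then have "emeasure (obs_law I b \<epsilon> (\<lambda>_. 0)) ?A \<le>
      emeasure (obs_law I b \<epsilon> ?\<theta>) ?A + ennreal (h\<^sup>2 / 2 + \<bar>h\<bar>)"
    using emeasure_white_noise_shift_le[OF i event[of "\<lambda>_. 0"], of h] unfolding emeasure_obs_law_test[OF t]
    by (meson add_right_mono order_trans)
  then have "measure (obs_law I b \<epsilon> (\<lambda>_. 0)) ?A \<le> measure (obs_law I b \<epsilon> ?\<theta>) ?A + (h\<^sup>2 / 2 + \<bar>h\<bar>)"
    by (simp add: P0.emeasure_eq_measure P1.emeasure_eq_measure ennreal_plus[symmetric] del: ennreal_plus)
  moreover have "1 - c \<le> measure (obs_law I b \<epsilon> (\<lambda>_. 0)) ?A"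
    using \<psi> unfolding measure_obs_law_test_0[OF t] by (simp add: level_tests_def)
  ultimately show ?thesis
    unfolding P1.emeasure_eq_measure by (intro ennreal_leI) linarith
qed

lemma minimax_type2_error_ge:
  assumes "i \<in> I" "\<epsilon> > 0" "(\<lambda>l. if l = i then z else 0) \<in> \<Theta>"
  shows "ennreal (1 - c - ((b i * z / \<epsilon>)\<^sup>2 / 2 + \<bar>b i * z / \<epsilon>\<bar>)) \<le> minimax_type2_error I b \<epsilon> \<Theta> c"
  unfolding minimax_type2_error_def type2_error_def
  by (intro INF_greatest SUP_upper2[OF assms(3)] spike_type2_error_ge assms)

lemma minimax_type2_error_le:
  assumes "\<psi> \<in> level_tests I b \<epsilon> c"
    and "\<And>\<theta>. \<theta> \<in> \<Theta> \<Longrightarrow> emeasure (obs_law I b \<epsilon> \<theta>) {y \<in> space (obs_space I). \<psi> y = 0} \<le> u"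
  shows "minimax_type2_error I b \<epsilon> \<Theta> c \<le> u"
  unfolding minimax_type2_error_def type2_error_def
  by (rule INF_lower2[OF assms(1)]) (auto intro: SUP_least assms(2))

text \<open>The one-sided test on \<open>y i\<close> at the Gaussian quantile has level exactly
  \<open>c\<close>. On \<open>\<Theta>\<close> the mean of \<open>y i / \<epsilon>\<close> is at
  most \<open>h\<close> in absolute value, which raises the acceptance probability above
  \<open>1 - c\<close> by no more than the shift bound.\<close>

lemma minimax_type2_error_le_coordinate:
  assumes i: "i \<in> I" and "\<epsilon> > 0" and c: "0 < c" "c < 1"
    and \<Theta>: "\<And>\<theta>. \<theta> \<in> \<Theta> \<Longrightarrow> \<bar>b i * \<theta> i / \<epsilon>\<bar> \<le> h"
  shows "minimax_type2_error I b \<epsilon> \<Theta> c \<le> ennreal (1 - c + (h\<^sup>2 / 2 + h))"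
proof -
  obtain q where q: "measure gauss {..q} = 1 - c"
    using gauss_quantile[of "1 - c"] c by auto
  interpret G: prob_space gauss by (rule prob_space_gauss)
  define \<psi> :: "('a \<Rightarrow> real) \<Rightarrow> nat" where "\<psi> y = (if y i \<le> \<epsilon> * q then 0 else 1)" for y
  have t: "\<psi> \<in> tests I"
    unfolding tests_def \<psi>_def using i by measurable
  have err: "emeasure (obs_law I b \<epsilon> \<theta>) {y \<in> space (obs_space I). \<psi> y = 0}
      = emeasure gauss {..q - b i * \<theta> i / \<epsilon>}" for \<theta>
  proof -
    have "{\<xi> \<in> space (white_noise I). \<psi> (\<lambda>l\<in>I. b l * \<theta> l + \<epsilon> * \<xi> l) = 0} =
      {\<xi> \<in> space (white_noise I). \<xi> i \<in> {..q - b i * \<theta> i / \<epsilon>}}"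
      using i \<open>\<epsilon> > 0\<close> by (auto simp: \<psi>_def field_simps split: if_splits)
    then show ?thesis
      by (simp only: emeasure_obs_law_test[OF t]) (simp only: emeasure_white_noise_component[OF i] borel_closed closed_atMost)
  qed
  show ?thesis
  proof (rule minimax_type2_error_le)
    have "measure (obs_law I b \<epsilon> (\<lambda>_. 0)) {y \<in> space (obs_space I). \<psi> y = 0} = 1 - c"
      using err[of "\<lambda>_. 0"] q by (simp add: measure_def)
    then show "\<psi> \<in> level_tests I b \<epsilon> c"
      using t measure_obs_law_test_0[OF t, of b \<epsilon> "\<lambda>_. 0"] by (simp add: level_tests_def)
  next
    fix \<theta> assume "\<theta> \<in> \<Theta>"
    define k where "k = b i * \<theta> i / \<epsilon>"
    have k: "\<bar>k\<bar> \<le> h" using \<Theta>[OF \<open>\<theta> \<in> \<Theta>\<close>] by (simp add: k_def)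
    have "k\<^sup>2 \<le> h\<^sup>2" using power_mono[OF k, of 2] by simp
    \<comment> \<open>Shifting by \<open>- k\<close> turns \<open>{..q - k}\<close> into
      \<open>{..q}\<close>, whose mass \<open>1 - c\<close> is known.\<close>
    have "emeasure gauss {..q - k} \<le> emeasure gauss {x. x + (- k) \<in> {..q - k}} + ennreal ((- k)\<^sup>2 / 2 + \<bar>- k\<bar>)"
      by (rule emeasure_gauss_shift_le) simp
    also have "{x. x + (- k) \<in> {..q - k}} = {..q}" by auto
    also have "emeasure gauss {..q} = ennreal (1 - c)" using q by (simp add: G.emeasure_eq_measure)
    also have "ennreal (1 - c) + ennreal ((- k)\<^sup>2 / 2 + \<bar>- k\<bar>) = ennreal (1 - c + ((- k)\<^sup>2 / 2 + \<bar>- k\<bar>))"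
      using c by (intro ennreal_plus[symmetric]) auto
    also have "\<dots> \<le> ennreal (1 - c + (h\<^sup>2 / 2 + h))"
      using k \<open>k\<^sup>2 \<le> h\<^sup>2\<close> by (intro ennreal_leI) simp
    finally show "emeasure (obs_law I b \<epsilon> \<theta>) {y \<in> space (obs_space I). \<psi> y = 0} \<le> ennreal (1 - c + (h\<^sup>2 / 2 + h))"
      by (simp add: err k_def)
  qed
qed

text \<open>Markov's inequality: every noise coordinate has second moment 1, so the sum has mean
  \<open>\<Sum>l\<in>F. (w l)\<^sup>2\<close>.\<close>

lemma white_noise_markov:
  assumes "finite F" "F \<subseteq> I" "T > 0"
  shows "emeasure (white_noise I) {\<xi> \<in> space (white_noise I). T \<le> (\<Sum>l\<in>F. (w l * \<xi> l)\<^sup>2)}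
    \<le> ennreal ((\<Sum>l\<in>F. (w l)\<^sup>2) / T)"
proof -
  let ?N = "white_noise I" and ?S = "\<lambda>\<xi>. \<Sum>l\<in>F. (w l * \<xi> l)\<^sup>2"
  have m: "(\<lambda>\<xi>. \<xi> l) \<in> borel_measurable ?N" if "l \<in> F" for l
    using that assms(2) by (intro measurable_white_noise_component) auto
  have S: "?S \<in> borel_measurable ?N"
    by (intro borel_measurable_sum borel_measurable_power borel_measurable_times borel_measurable_const m)
  \<comment> \<open>\<open>nn_integral_Markov_inequality\<close> expects the event in the form
    \<open>1 \<le> c * u\<close>, here with \<open>c = 1 / T\<close>.\<close>
  have "{\<xi> \<in> space ?N. T \<le> ?S \<xi>} = {\<xi> \<in> space ?N. 1 \<le> ennreal (1 / T) * ennreal (?S \<xi>)}"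
  proof -
    have "1 \<le> ennreal (1 / T) * ennreal (?S \<xi>) \<longleftrightarrow> T \<le> ?S \<xi>" for \<xi>
    proof -
      have "ennreal (1 / T) * ennreal (?S \<xi>) = ennreal (?S \<xi> / T)"
        using \<open>T > 0\<close> by (simp add: ennreal_mult''[symmetric] sum_nonneg)
      then show ?thesis using \<open>T > 0\<close> by simp
    qed
    then show ?thesis by simp
  qed
  then have "emeasure ?N {\<xi> \<in> space ?N. T \<le> ?S \<xi>} =
    emeasure ?N {\<xi> \<in> space ?N. 1 \<le> ennreal (1 / T) * ennreal (?S \<xi>)}" by (rule arg_cong)
  also have "\<dots> \<le> ennreal (1 / T) * (\<integral>\<^sup>+\<xi>. ennreal (?S \<xi>) * indicator (space ?N) \<xi> \<partial>?N)"
  proof (rule nn_integral_Markov_inequality)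
    have "(\<lambda>\<xi>. ennreal (?S \<xi>)) \<in> borel_measurable ?N"
      by (rule measurable_compose[OF S measurable_ennreal])
    then show "(\<lambda>\<xi>. ennreal (?S \<xi>) * indicator (space ?N) \<xi>) \<in> borel_measurable ?N"
      by (intro borel_measurable_times_ennreal borel_measurable_indicator sets.top)
  qed (rule sets.top)
  also have "(\<integral>\<^sup>+\<xi>. ennreal (?S \<xi>) * indicator (space ?N) \<xi> \<partial>?N)
      = (\<integral>\<^sup>+\<xi>. (\<Sum>l\<in>F. ennreal ((w l)\<^sup>2) * ennreal ((\<xi> l)\<^sup>2)) \<partial>?N)"
  proof (intro nn_integral_cong)
    fix \<xi> assume "\<xi> \<in> space ?N"
    moreover have "ennreal (?S \<xi>) = (\<Sum>l\<in>F. ennreal ((w l * \<xi> l)\<^sup>2))"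
      by (rule sum_ennreal[symmetric]) simp
    moreover have "ennreal ((w l * \<xi> l)\<^sup>2) = ennreal ((w l)\<^sup>2) * ennreal ((\<xi> l)\<^sup>2)" for l
      unfolding power_mult_distrib by (rule ennreal_mult) simp_all
    ultimately show "ennreal (?S \<xi>) * indicator (space ?N) \<xi>
        = (\<Sum>l\<in>F. ennreal ((w l)\<^sup>2) * ennreal ((\<xi> l)\<^sup>2))"
      by (simp only: indicator_simps mult_1_right)
  qed
  also have "\<dots> = (\<Sum>l\<in>F. \<integral>\<^sup>+\<xi>. ennreal ((w l)\<^sup>2) * ennreal ((\<xi> l)\<^sup>2) \<partial>?N)"
    by (intro nn_integral_sum borel_measurable_times_ennreal borel_measurable_const
      measurable_compose[OF borel_measurable_power measurable_ennreal] m)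
  also have "\<dots> = (\<Sum>l\<in>F. ennreal ((w l)\<^sup>2))"
  proof (intro sum.cong refl)
    fix l assume "l \<in> F"
    then have "l \<in> I" using assms(2) by auto
    then show "(\<integral>\<^sup>+\<xi>. ennreal ((w l)\<^sup>2) * ennreal ((\<xi> l)\<^sup>2) \<partial>?N) = ennreal ((w l)\<^sup>2)"
      by (subst nn_integral_cmult) (simp_all add: nn_integral_white_noise_component_square)
  qed
  also have "\<dots> = ennreal (\<Sum>l\<in>F. (w l)\<^sup>2)" by (simp add: sum_ennreal)
  also have "ennreal (1 / T) * \<dots> = ennreal ((\<Sum>l\<in>F. (w l)\<^sup>2) / T)"
    using \<open>T > 0\<close> by (simp add: ennreal_mult''[symmetric] sum_nonneg)
  finally show ?thesis .
qed

text \<open>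
  The test rejects when \<open>\<Sum>l\<in>F. (y l / b l)\<^sup>2\<close> exceeds \<open>r\<^sup>2 / 8\<close>. Both errors force
  \<open>\<Sum>l\<in>F. (\<epsilon> / b l * \<xi> l)\<^sup>2 \<ge> r\<^sup>2 / 8\<close>, so Markov's inequality suffices.
\<close>

lemma minimax_type2_error_le_energy:
  assumes F: "finite F" "F \<subseteq> I" "\<And>l. l \<in> F \<Longrightarrow> b l \<noteq> 0" and "\<epsilon> > 0" and r: "r > 0"
    and c: "8 * (\<Sum>l\<in>F. (\<epsilon> / b l)\<^sup>2) / r\<^sup>2 \<le> c"
    and \<Theta>: "\<And>\<theta>. \<theta> \<in> \<Theta> \<Longrightarrow> r\<^sup>2 / 2 \<le> (\<Sum>l\<in>F. (\<theta> l)\<^sup>2)"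
  shows "minimax_type2_error I b \<epsilon> \<Theta> c \<le> ennreal (8 * (\<Sum>l\<in>F. (\<epsilon> / b l)\<^sup>2) / r\<^sup>2)"
proof -
  let ?N = "white_noise I" and ?V = "\<Sum>l\<in>F. (\<epsilon> / b l)\<^sup>2"
  define \<psi> :: "('a \<Rightarrow> real) \<Rightarrow> nat" where
    "\<psi> y = (if (\<Sum>l\<in>F. (y l / b l)\<^sup>2) \<le> r\<^sup>2 / 8 then 0 else 1)" for y
  have "(\<lambda>y. \<Sum>l\<in>F. (y l / b l)\<^sup>2) \<in> borel_measurable (obs_space I)"
    using F(2) by (intro borel_measurable_sum borel_measurable_divide borel_measurable_power
      borel_measurable_const measurable_obs_component) auto
  then have t: "\<psi> \<in> tests I"
    unfolding tests_def \<psi>_def by measurable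
  have markov: "emeasure ?N {\<xi> \<in> space ?N. r\<^sup>2 / 8 \<le> (\<Sum>l\<in>F. (\<epsilon> / b l * \<xi> l)\<^sup>2)} \<le> ennreal (8 * ?V / r\<^sup>2)"
    using white_noise_markov[OF F(1,2), of "r\<^sup>2 / 8" "\<lambda>l. \<epsilon> / b l"] r by (simp add: mult.commute)
  have m: "(\<lambda>\<xi>. \<xi> l) \<in> borel_measurable ?N" if "l \<in> F" for l
    using that F(2) by (intro measurable_white_noise_component) auto
  have "(\<lambda>\<xi>. \<Sum>l\<in>F. (\<epsilon> / b l * \<xi> l)\<^sup>2) \<in> borel_measurable ?N"
    by (intro borel_measurable_sum borel_measurable_power borel_measurable_times borel_measurable_const m)
  then have sets: "{\<xi> \<in> space ?N. r\<^sup>2 / 8 \<le> (\<Sum>l\<in>F. (\<epsilon> / b l * \<xi> l)\<^sup>2)} \<in> sets ?N"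
    by (intro borel_measurable_le borel_measurable_const)
  have obs: "(\<Sum>l\<in>F. ((\<lambda>l\<in>I. b l * \<theta> l + \<epsilon> * \<xi> l) l / b l)\<^sup>2) = (\<Sum>l\<in>F. (\<theta> l + \<epsilon> / b l * \<xi> l)\<^sup>2)" for \<theta> \<xi>
    using F by (intro sum.cong refl) (auto simp: field_simps)
  show ?thesis
  proof (rule minimax_type2_error_le)
    have "emeasure (obs_law I b \<epsilon> (\<lambda>_. 0)) {y \<in> space (obs_space I). \<psi> y = 1}
      = emeasure ?N {\<xi> \<in> space ?N. \<psi> (\<lambda>l\<in>I. b l * 0 + \<epsilon> * \<xi> l) = 1}"
      by (rule emeasure_obs_law_test[OF t])
    also have "\<dots> \<le> emeasure ?N {\<xi> \<in> space ?N. r\<^sup>2 / 8 \<le> (\<Sum>l\<in>F. (\<epsilon> / b l * \<xi> l)\<^sup>2)}"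
      using obs[of "\<lambda>_. 0"] by (intro emeasure_mono sets) (auto simp: \<psi>_def split: if_splits)
    also note markov
    finally have "measure (obs_law I b \<epsilon> (\<lambda>_. 0)) {y \<in> space (obs_space I). \<psi> y = 1} \<le> 8 * ?V / r\<^sup>2"
      unfolding measure_def by (intro enn2real_leI) (simp_all add: sum_nonneg)
    then show "\<psi> \<in> level_tests I b \<epsilon> c"
      using t c by (simp add: level_tests_def)
  next
    fix \<theta> assume "\<theta> \<in> \<Theta>"
    \<comment> \<open>The difference of the two sides is the square
      \<open>(\<theta> l + 2 * x)\<^sup>2\<close>.\<close>
    have le: "(\<theta> l)\<^sup>2 \<le> 2 * (\<theta> l + x)\<^sup>2 + 2 * x\<^sup>2" for l x
      using zero_le_power2[of "\<theta> l + 2 * x"] by (simp add: power2_eq_square algebra_simps)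
    have bound: "(\<Sum>l\<in>F. (\<theta> l)\<^sup>2) \<le> 2 * (\<Sum>l\<in>F. (\<theta> l + \<epsilon> / b l * \<xi> l)\<^sup>2) + 2 * (\<Sum>l\<in>F. (\<epsilon> / b l * \<xi> l)\<^sup>2)" for \<xi>
      unfolding sum_distrib_left sum.distrib[symmetric] by (intro sum_mono le)
    \<comment> \<open>The threshold is fitted here: signal energy \<open>r\<^sup>2 / 2\<close> minus
      twice \<open>r\<^sup>2 / 8\<close> leaves \<open>r\<^sup>2 / 4\<close> to be covered by twice
      the noise energy.\<close>
    have "r\<^sup>2 / 8 \<le> (\<Sum>l\<in>F. (\<epsilon> / b l * \<xi> l)\<^sup>2)"
      if "(\<Sum>l\<in>F. (\<theta> l + \<epsilon> / b l * \<xi> l)\<^sup>2) \<le> r\<^sup>2 / 8" for \<xi>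
      using that bound[of \<xi>] \<Theta>[OF \<open>\<theta> \<in> \<Theta>\<close>] by linarith
    then have "emeasure ?N {\<xi> \<in> space ?N. \<psi> (\<lambda>l\<in>I. b l * \<theta> l + \<epsilon> * \<xi> l) = 0}
      \<le> emeasure ?N {\<xi> \<in> space ?N. r\<^sup>2 / 8 \<le> (\<Sum>l\<in>F. (\<epsilon> / b l * \<xi> l)\<^sup>2)}"
      using obs[of \<theta>] by (intro emeasure_mono sets) (auto simp: \<psi>_def split: if_splits)
    also note markov
    finally show "emeasure (obs_law I b \<epsilon> \<theta>) {y \<in> space (obs_space I). \<psi> y = 0} \<le> ennreal (8 * ?V / r\<^sup>2)"
      by (simp only: emeasure_obs_law_test[OF t])
  qed
qed

section \<open>Spikes and energy in the ellipsoid\<close>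

lemma ellipsoid_spike:
  assumes "i \<in> I" "\<bar>a i * z\<bar> \<le> R" "0 \<le> r" "r \<le> z"
  shows "(\<lambda>l. if l = i then z else 0) \<in> ellipsoid_away I a R r"
proof -
  let ?\<theta> = "\<lambda>l. if l = i then z else 0"
  have "((\<lambda>l. (?\<theta> l)\<^sup>2) has_sum z\<^sup>2) I" "((\<lambda>l. (a l)\<^sup>2 * (?\<theta> l)\<^sup>2) has_sum (a i * z)\<^sup>2) I"
    using assms(1) by (auto intro!: has_sum_finite_neutralI[of "{i}"] simp: power_mult_distrib split: if_splits)
  moreover have "(a i * z)\<^sup>2 \<le> R\<^sup>2" using power_mono[OF assms(2), of 2] by simp
  ultimately show ?thesis
    using assms(3,4) by (auto simp: ellipsoid_away_def ellipsoid_def l2_def l2norm_def infsumI summable_on_def)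
qed

lemma ellipsoid_coordinate_le:
  assumes "\<theta> \<in> ellipsoid I a R" "i \<in> I" "0 \<le> R"
  shows "\<bar>a i * \<theta> i\<bar> \<le> R"
proof -
  have "(\<Sum>l\<in>{i}. (a l)\<^sup>2 * (\<theta> l)\<^sup>2) \<le> (\<Sum>\<^sub>\<infinity>l\<in>I. (a l)\<^sup>2 * (\<theta> l)\<^sup>2)"
    using assms by (intro finite_sum_le_infsum) (auto simp: ellipsoid_def)
  with assms have "(a i * \<theta> i)\<^sup>2 \<le> R\<^sup>2" by (auto simp: ellipsoid_def power_mult_distrib)
  then show ?thesis using assms(3) by (metis abs_le_square_iff abs_of_nonneg)
qed

text \<open>Outside \<open>F\<close> each squared coefficient is at most its ellipsoid term divided
  by \<open>M\<^sup>2\<close>, so the tail holds at most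
  \<open>R\<^sup>2 / M\<^sup>2 \<le> r\<^sup>2 / 2\<close> of the energy.\<close>

lemma ellipsoid_away_energy:
  assumes \<theta>: "\<theta> \<in> ellipsoid_away I a R r" and "r > 0" and M: "M > 0" "2 * R\<^sup>2 \<le> (M * r)\<^sup>2"
    and F: "finite F" "F \<subseteq> I" "\<And>l. l \<in> I - F \<Longrightarrow> M \<le> \<bar>a l\<bar>"
  shows "r\<^sup>2 / 2 \<le> (\<Sum>l\<in>F. (\<theta> l)\<^sup>2)"
proof -
  have s: "(\<lambda>l. (\<theta> l)\<^sup>2) summable_on I" "(\<lambda>l. (a l)\<^sup>2 * (\<theta> l)\<^sup>2) summable_on I"
    and R: "(\<Sum>\<^sub>\<infinity>l\<in>I. (a l)\<^sup>2 * (\<theta> l)\<^sup>2) \<le> R\<^sup>2" and n: "r \<le> l2norm I \<theta>"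
    using \<theta> by (auto simp: ellipsoid_away_def ellipsoid_def l2_def)
  have "r\<^sup>2 \<le> (\<Sum>\<^sub>\<infinity>l\<in>I. (\<theta> l)\<^sup>2)"
    using power_mono[OF n, of 2] \<open>r > 0\<close> by (simp add: l2norm_def infsum_nonneg)
  \<comment> \<open>A termwise comparison over all of \<open>I\<close> takes the place of splitting
    the infinite sum: the first summand covers \<open>F\<close>, the second the tail.\<close>
  also have "\<dots> \<le> (\<Sum>\<^sub>\<infinity>l\<in>I. (if l \<in> F then (\<theta> l)\<^sup>2 else 0) + 1 / M\<^sup>2 * ((a l)\<^sup>2 * (\<theta> l)\<^sup>2))"
  proof (rule infsum_mono[OF s(1)])
    show "(\<lambda>l. (if l \<in> F then (\<theta> l)\<^sup>2 else 0) + 1 / M\<^sup>2 * ((a l)\<^sup>2 * (\<theta> l)\<^sup>2)) summable_on I"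
    proof (rule summable_on_add)
      show "(\<lambda>l. if l \<in> F then (\<theta> l)\<^sup>2 else 0) summable_on I"
        using F by (intro finite_nonzero_values_imp_summable_on) (auto intro: finite_subset[of _ F])
    qed (rule summable_on_cmult_right[OF s(2)])
    fix l assume "l \<in> I"
    show "(\<theta> l)\<^sup>2 \<le> (if l \<in> F then (\<theta> l)\<^sup>2 else 0) + 1 / M\<^sup>2 * ((a l)\<^sup>2 * (\<theta> l)\<^sup>2)"
    proof (cases "l \<in> F")
      case False
      then have "M\<^sup>2 \<le> (a l)\<^sup>2" using power_mono[OF F(3)[of l], of 2] \<open>l \<in> I\<close> M by simp
      then have "M\<^sup>2 * (\<theta> l)\<^sup>2 \<le> (a l)\<^sup>2 * (\<theta> l)\<^sup>2" by (rule mult_right_mono) simp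
      then show ?thesis using False M by (simp add: field_simps)
    qed simp
  qed
  also have "\<dots> = (\<Sum>l\<in>F. (\<theta> l)\<^sup>2) + 1 / M\<^sup>2 * (\<Sum>\<^sub>\<infinity>l\<in>I. (a l)\<^sup>2 * (\<theta> l)\<^sup>2)"
  proof -
    have "((\<lambda>l. if l \<in> F then (\<theta> l)\<^sup>2 else 0) has_sum (\<Sum>l\<in>F. (\<theta> l)\<^sup>2)) I"
      using F by (intro has_sum_finite_neutralI[of F]) auto
    then show ?thesis
      by (intro infsumI has_sum_add has_sum_cmult_right has_sum_infsum s)
  qed
  also have "1 / M\<^sup>2 * (\<Sum>\<^sub>\<infinity>l\<in>I. (a l)\<^sup>2 * (\<theta> l)\<^sup>2) \<le> 1 / M\<^sup>2 * R\<^sup>2"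
    using R by (rule mult_left_mono) simp
  also have "1 / M\<^sup>2 * R\<^sup>2 \<le> r\<^sup>2 / 2"
    using M by (simp add: field_simps power_mult_distrib)
  finally show ?thesis by simp
qed

section \<open>Uniqueness of separation rates up to constants\<close>

text \<open>
  If \<open>u / v\<close> were not bounded away from \<open>0\<close>, the geometric mean of \<open>u\<close> and \<open>v\<close> would, along a sequence
  tending to \<open>0\<close>, be a radius of infinite order relative to \<open>u\<close> and of vanishing order relative to \<open>v\<close>.
\<close>

lemma separation_rate_dominates:
  assumes u: "minimax_separation_rate I b a R \<alpha> \<delta> u" and v: "minimax_separation_rate I b a R \<alpha> \<delta> v"
    and "\<alpha> < 1"
  shows "\<exists>k>0. \<forall>\<^sub>F \<epsilon> in at_right 0. k * v \<epsilon> \<le> u \<epsilon>"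
proof (rule ccontr)
  assume "\<not> ?thesis"
  then have neg: "\<exists>\<^sub>F \<epsilon> in at_right 0. u \<epsilon> < k * v \<epsilon>" if "k > 0" for k
    using that unfolding frequently_def not_less by blast
  have pos: "u \<epsilon> > 0" "v \<epsilon> > 0" if "\<epsilon> > 0" for \<epsilon>
    using u v that by (auto simp: minimax_separation_rate_def)
  have "\<exists>\<epsilon>. 0 < \<epsilon> \<and> \<epsilon> < 1 / Suc n \<and> u \<epsilon> < 1 / Suc n * v \<epsilon>" for n
  proof -
    have "\<forall>\<^sub>F \<epsilon> in at_right 0. 0 < \<epsilon> \<and> \<epsilon> < 1 / real (Suc n)"
      by (auto simp: eventually_at_right_field intro!: exI[of _ "1 / real (Suc n)"])
    from frequently_eventually_frequently[OF neg[of "1 / Suc n"] this]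
    show ?thesis by (auto dest: frequently_ex)
  qed
  then obtain e where e: "\<And>n. 0 < e n" "\<And>n. e n < 1 / Suc n" "\<And>n. u (e n) < 1 / Suc n * v (e n)"
    by metis
  \<comment> \<open>On the sequence, \<open>w\<close> makes both \<open>u / w\<close> and
    \<open>v * w\<close> the geometric mean of \<open>u\<close> and \<open>v\<close>. The value
    \<open>\<epsilon>\<close> elsewhere is positive and vanishes, so that both radii have their
    order on the whole filter and not just along the sequence.\<close>
  define w where "w \<epsilon> = (if \<epsilon> \<in> range e then sqrt (u \<epsilon> / v \<epsilon>) else \<epsilon>)" for \<epsilon>
  have w_pos: "w \<epsilon> > 0" if "\<epsilon> > 0" for \<epsilon>
    using that pos by (auto simp: w_def)
  have ev_pos: "\<forall>\<^sub>F \<epsilon> in at_right 0. (0::real) < \<epsilon>" by (rule eventually_at_right_less)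
  have w_lim: "(w \<longlongrightarrow> 0) (at_right 0)"
  proof (rule tendstoI)
    fix c :: real assume "c > 0"
    then obtain n where n: "1 / Suc n < c\<^sup>2"
      using reals_Archimedean[of "c\<^sup>2"] by (auto simp: inverse_eq_divide)
    \<comment> \<open>Below \<open>m\<close> only sequence members with index above \<open>n\<close>
      occur, and for them \<open>u / v < 1 / Suc n < c\<^sup>2\<close>.\<close>
    define m where "m = Min (insert c (e ` {..n}))"
    have m: "m > 0" "m \<le> c" using \<open>c > 0\<close> e(1) by (auto simp: m_def)
    have m_le: "m \<le> e k" if "k \<le> n" for k
      unfolding m_def using that by (intro Min_le) auto
    have "\<bar>w \<epsilon>\<bar> < c" if \<epsilon>: "0 < \<epsilon>" "\<epsilon> < m" for \<epsilon>
    proof (cases "\<epsilon> \<in> range e")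
      case True
      then obtain k where k: "\<epsilon> = e k" by auto
      with \<epsilon> m_le[of k] have "n < k" by (cases "k \<le> n") auto
      have "u \<epsilon> / v \<epsilon> < 1 / Suc k" using e(3)[of k] pos \<epsilon> by (simp add: k field_simps)
      also have "\<dots> \<le> 1 / Suc n" using \<open>n < k\<close> by (intro divide_left_mono) auto
      also note n
      finally have "sqrt (u \<epsilon> / v \<epsilon>) < sqrt (c\<^sup>2)" by (rule real_sqrt_less_mono)
      then show ?thesis using True w_pos[OF \<epsilon>(1)] \<open>c > 0\<close> by (simp add: w_def)
    qed (use \<epsilon> m in \<open>simp add: w_def\<close>)
    then show "\<forall>\<^sub>F \<epsilon> in at_right 0. dist (w \<epsilon>) 0 < c"
      using m(1) by (auto simp: eventually_at_right_field)
  qed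
  let ?f = "\<lambda>r \<epsilon>. minimax_type2_error I b \<epsilon> (ellipsoid_away I a R (r \<epsilon>)) (\<alpha> + \<delta> \<epsilon>)"
  have "filterlim (\<lambda>\<epsilon>. u \<epsilon> / w \<epsilon> / u \<epsilon>) at_top (at_right 0)"
  proof -
    have "filterlim (\<lambda>\<epsilon>. inverse (w \<epsilon>)) at_top (at_right 0)"
      using w_lim by (rule filterlim_inverse_at_top) (use ev_pos w_pos in \<open>auto elim: eventually_mono\<close>)
    moreover have "\<forall>\<^sub>F \<epsilon> in at_right 0. inverse (w \<epsilon>) = u \<epsilon> / w \<epsilon> / u \<epsilon>"
      using ev_pos by eventually_elim (use pos in \<open>fastforce simp: field_simps\<close>)
    ultimately show ?thesis by (rule filterlim_mono_eventually[OF _ order_refl order_refl])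
  qed
  then have f1: "(?f (\<lambda>\<epsilon>. u \<epsilon> / w \<epsilon>) \<longlongrightarrow> 0) (at_right 0)"
    using u pos w_pos unfolding minimax_separation_rate_def by auto
  have "((\<lambda>\<epsilon>. v \<epsilon> * w \<epsilon> / v \<epsilon>) \<longlongrightarrow> 0) (at_right 0)"
  proof (rule Lim_transform_eventually[OF w_lim])
    show "\<forall>\<^sub>F \<epsilon> in at_right 0. w \<epsilon> = v \<epsilon> * w \<epsilon> / v \<epsilon>"
      using ev_pos by eventually_elim (use pos in \<open>fastforce simp: field_simps\<close>)
  qed
  then have f2: "(?f (\<lambda>\<epsilon>. v \<epsilon> * w \<epsilon>) \<longlongrightarrow> ennreal (1 - \<alpha>)) (at_right 0)"
    using v pos w_pos unfolding minimax_separation_rate_def by auto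
  \<comment> \<open>At \<open>e n\<close> the two radii coincide, so one and the same minimax error
    would have to be near 0 and near \<open>1 - \<alpha>\<close>.\<close>
  have eq: "u (e n) / w (e n) = v (e n) * w (e n)" for n
  proof -
    have "w (e n) * w (e n) = u (e n) / v (e n)"
      using pos[OF e(1)[of n]] by (simp add: w_def)
    then show ?thesis using pos[OF e(1)[of n]] w_pos[OF e(1)[of n]] by (simp add: field_simps)
  qed
  have "0 < ennreal ((1 - \<alpha>) / 2)" "ennreal ((1 - \<alpha>) / 2) < ennreal (1 - \<alpha>)"
    using \<open>\<alpha> < 1\<close> by (auto simp: ennreal_less_iff)
  from order_tendstoD(2)[OF f1 this(1)] order_tendstoD(1)[OF f2 this(2)]
  have "\<forall>\<^sub>F \<epsilon> in at_right 0. ?f (\<lambda>\<epsilon>. u \<epsilon> / w \<epsilon>) \<epsilon> < ?f (\<lambda>\<epsilon>. v \<epsilon> * w \<epsilon>) \<epsilon>"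
    by eventually_elim (rule less_trans)
  then obtain c where c: "c > 0" "\<And>\<epsilon>. 0 < \<epsilon> \<Longrightarrow> \<epsilon> < c \<Longrightarrow> ?f (\<lambda>\<epsilon>. u \<epsilon> / w \<epsilon>) \<epsilon> < ?f (\<lambda>\<epsilon>. v \<epsilon> * w \<epsilon>) \<epsilon>"
    by (auto simp: eventually_at_right_field)
  from c(1) obtain n where "1 / Suc n < c"
    using reals_Archimedean[of c] by (auto simp: inverse_eq_divide)
  with e(2)[of n] have "e n < c" by linarith
  from c(2)[OF e(1) this] show False by (simp add: eq)
qed

section \<open>Sums of exponential weights over multi-indices\<close>

text \<open>Only finitely many exponents occur in \<open>G\<close>, so it fits into a box with sides
  \<open>{..N}\<close>, over which the sum factors into truncated geometric series.\<close>

lemma sum_prod_power_le: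
  fixes q :: "'j \<Rightarrow> real"
  assumes J: "finite J" and q: "\<And>j. j \<in> J \<Longrightarrow> 0 \<le> q j" "\<And>j. j \<in> J \<Longrightarrow> q j < 1"
    and G: "finite G" "G \<subseteq> (\<Pi>\<^sub>E j\<in>J. UNIV)"
  shows "(\<Sum>m\<in>G. \<Prod>j\<in>J. q j ^ m j) \<le> (\<Prod>j\<in>J. 1 / (1 - q j))"
proof -
  have "finite (\<Union>m\<in>G. m ` J)" using J G by auto
  then obtain N where N: "\<And>m j. m \<in> G \<Longrightarrow> j \<in> J \<Longrightarrow> m j \<le> N"
    unfolding finite_nat_set_iff_bounded_le by blast
  have "(\<Sum>m\<in>G. \<Prod>j\<in>J. q j ^ m j) \<le> (\<Sum>m\<in>(\<Pi>\<^sub>E j\<in>J. {..N}). \<Prod>j\<in>J. q j ^ m j)"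
  proof (rule sum_mono2)
    show "finite (\<Pi>\<^sub>E j\<in>J. {..N})" using J by (intro finite_PiE) auto
    show "G \<subseteq> (\<Pi>\<^sub>E j\<in>J. {..N})" using G(2) N by (auto simp: PiE_iff subset_iff)
    fix m assume "m \<in> (\<Pi>\<^sub>E j\<in>J. {..N}) - G"
    show "0 \<le> (\<Prod>j\<in>J. q j ^ m j)" using q(1) by (intro prod_nonneg zero_le_power) auto
  qed
  also have "\<dots> = (\<Prod>j\<in>J. \<Sum>k\<le>N. q j ^ k)"
    using J by (subst prod_sum_PiE) auto
  also have "\<dots> \<le> (\<Prod>j\<in>J. 1 / (1 - q j))"
  proof (rule prod_mono, intro conjI)
    fix j assume j: "j \<in> J"
    show "0 \<le> (\<Sum>k\<le>N. q j ^ k)" using q(1)[OF j] by (intro sum_nonneg) auto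
    have "(\<Sum>k\<in>{..N}. q j ^ k) \<le> (\<Sum>k. q j ^ k)"
      using q[OF j] by (intro sum_le_suminf summable_geometric) auto
    also have "\<dots> = 1 / (1 - q j)" using q[OF j] by (intro suminf_geometric) auto
    finally show "(\<Sum>k\<le>N. q j ^ k) \<le> 1 / (1 - q j)" .
  qed
  finally show ?thesis .
qed

lemma sum_split_first:
  fixes f :: "nat \<Rightarrow> real"
  assumes "d \<ge> 1"
  shows "(\<Sum>j=1..d. f j) = f 1 + (\<Sum>j=2..d. f j)"
  using assms by (simp add: sum.atLeast_Suc_atMost numeral_2_eq_2)

text \<open>
  Replacing \<open>l\<^sub>1\<close> by the slack \<open>\<lfloor>(L - (\<Sum>j. s\<^sub>j l\<^sub>j)) / s\<^sub>1\<rfloor>\<close> is injective on \<open>F\<close> and turns the sum into a product of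
  convergent geometric series, since \<open>t\<^sub>j < (t\<^sub>1 / s\<^sub>1) s\<^sub>j\<close> for \<open>j \<ge> 2\<close>.
\<close>

lemma exp_weights_count:
  fixes s t :: "nat \<Rightarrow> real" and L :: real
  assumes d: "d \<ge> 1" and s: "\<And>j. j \<in> {1..d} \<Longrightarrow> s j > 0" and "t 1 > 0"
    and ts: "\<And>j. j \<in> {2..d} \<Longrightarrow> t j / s j < t 1 / s 1"
  defines "q \<equiv> \<lambda>j. exp (- 2 * (if j = 1 then t 1 else t 1 / s 1 * s j - t j))"
  defines "F \<equiv> {l \<in> multi_idx d. (\<Sum>j=1..d. s j * real (l j)) \<le> L}"
  shows "finite F"
    and "(\<Sum>l\<in>F. exp (2 * (\<Sum>j=1..d. t j * real (l j)))) \<le> exp (2 * (t 1 / s 1) * L) * (\<Prod>j=1..d. 1 / (1 - q j))"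
proof -
  define A where "A l = (\<Sum>j=1..d. s j * real (l j))" for l :: "nat \<Rightarrow> nat"
  define B where "B l = (\<Sum>j=1..d. t j * real (l j))" for l :: "nat \<Rightarrow> nat"
  \<comment> \<open>Decay rates: \<open>q j = exp (- 2 * c j)\<close>. For \<open>j \<ge> 2\<close>
    their positivity is the strict dominance of the first axis; the entry \<open>t 1\<close> at
    \<open>j = 1\<close> is paired with the slack \<open>k l\<close>.\<close>
  define c where "c j = (if j = 1 then t 1 else t 1 / s 1 * s j - t j)" for j
  define k where "k l = nat \<lfloor>(L - A l) / s 1\<rfloor>" for l
  define \<Phi> where "\<Phi> l = l(1 := k l)" for l
  have s1: "s 1 > 0" using s[of 1] d by simp
  note split = sum_split_first[OF d]
  have c_pos: "c j > 0" if "j \<in> {1..d}" for j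
  proof (cases "j = 1")
    case False
    with that have "t j / s j < t 1 / s 1" using ts[of j] by auto
    then show ?thesis using False s[OF that] by (simp add: c_def pos_divide_less_eq)
  qed (use \<open>t 1 > 0\<close> in \<open>simp add: c_def\<close>)
  show fin: "finite F"
  proof (rule finite_subset)
    show "finite (\<Pi>\<^sub>E j\<in>{1..d}. {..nat \<lfloor>L / s j\<rfloor>})" by (intro finite_PiE) auto
    show "F \<subseteq> (\<Pi>\<^sub>E j\<in>{1..d}. {..nat \<lfloor>L / s j\<rfloor>})"
    proof
      fix l assume l: "l \<in> F"
      have "l j \<le> nat \<lfloor>L / s j\<rfloor>" if j: "j \<in> {1..d}" for j
      proof -
        have "s j * real (l j) \<le> (\<Sum>j=1..d. s j * real (l j))"
          using j less_imp_le[OF s] by (intro member_le_sum mult_nonneg_nonneg) auto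
        also have "\<dots> \<le> L" using l by (simp add: F_def)
        finally have "real (l j) \<le> L / s j" using s[OF j] by (simp add: field_simps)
        then show ?thesis by (simp add: le_nat_floor)
      qed
      then show "l \<in> (\<Pi>\<^sub>E j\<in>{1..d}. {..nat \<lfloor>L / s j\<rfloor>})"
        using l by (auto simp: F_def multi_idx_def PiE_iff)
    qed
  qed
  have inj: "inj_on \<Phi> F"
  proof (rule inj_onI)
    fix l l' assume l: "l \<in> F" "l' \<in> F" and eq: "\<Phi> l = \<Phi> l'"
    have off: "l j = l' j" if "j \<noteq> 1" for j
      using fun_cong[OF eq, of j] that by (simp add: \<Phi>_def)
    \<comment> \<open>For indices that agree off the first axis, the quotients inside the floor
      differ by the integer \<open>l 1 - l' 1\<close>, so rounding down loses nothing. On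
      \<open>F\<close> the floors are nonnegative, so \<open>nat\<close> does not truncate
      either.\<close>
    have "A l - A l' = s 1 * (real (l 1) - real (l' 1))"
      unfolding A_def split using off by (simp add: algebra_simps)
    then have "(L - A l') / s 1 = (L - A l) / s 1 + of_int (int (l 1) - int (l' 1))"
      using s1 by (simp add: field_simps)
    then have fl: "\<lfloor>(L - A l') / s 1\<rfloor> = \<lfloor>(L - A l) / s 1\<rfloor> + (int (l 1) - int (l' 1))"
      by (metis floor_add_int)
    have "\<lfloor>(L - A l) / s 1\<rfloor> \<ge> 0" "\<lfloor>(L - A l') / s 1\<rfloor> \<ge> 0"
      using l s1 by (simp_all add: F_def A_def)
    moreover have "k l = k l'" using fun_cong[OF eq, of 1] by (simp add: \<Phi>_def)
    ultimately have "l 1 = l' 1" using fl unfolding k_def by linarith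
    with off show "l = l'" by (metis ext)
  qed
  have summand: "exp (2 * B l) \<le> exp (2 * (t 1 / s 1) * L) * (\<Prod>j=1..d. q j ^ \<Phi> l j)" if l: "l \<in> F" for l
  proof -
    have "(L - A l) / s 1 \<ge> 0" using l s1 by (simp add: F_def A_def)
    then have "real (k l) \<le> (L - A l) / s 1" by (simp add: k_def)
    then have "A l \<le> L - s 1 * k l" using s1 by (simp add: field_simps)
    then have "t 1 / s 1 * A l \<le> t 1 / s 1 * (L - s 1 * k l)"
      using s1 \<open>t 1 > 0\<close> by (intro mult_left_mono) auto
    then have "t 1 / s 1 * A l \<le> t 1 / s 1 * L - t 1 * k l"
      using s1 by (simp add: field_simps)
    \<comment> \<open>At \<open>j = 1\<close> the terms of \<open>B l\<close> and
      \<open>t 1 / s 1 * A l\<close> are equal; the others differ by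
      \<open>c j * real (l j)\<close>.\<close>
    moreover have "B l = t 1 / s 1 * A l - (\<Sum>j=2..d. c j * real (l j))"
    proof -
      have "(\<Sum>j=2..d. c j * real (l j))
          = t 1 / s 1 * (\<Sum>j=2..d. s j * real (l j)) - (\<Sum>j=2..d. t j * real (l j))"
        unfolding sum_distrib_left sum_subtractf[symmetric]
        by (intro sum.cong) (auto simp: c_def algebra_simps)
      moreover have "t 1 / s 1 * (s 1 * real (l 1)) = t 1 * real (l 1)" using s1 by simp
      ultimately show ?thesis
        unfolding A_def B_def split distrib_left by linarith
    qed
    moreover have "(\<Sum>j=1..d. c j * real (\<Phi> l j)) = t 1 * k l + (\<Sum>j=2..d. c j * real (l j))"
      unfolding split by (auto simp: \<Phi>_def c_def intro!: sum.cong)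
    ultimately have "2 * B l \<le> 2 * (t 1 / s 1) * L + (\<Sum>j=1..d. - 2 * c j * real (\<Phi> l j))"
      by (simp add: sum_negf sum_distrib_left[symmetric] mult.assoc)
    then have "exp (2 * B l) \<le> exp (2 * (t 1 / s 1) * L) * exp (\<Sum>j=1..d. - 2 * c j * real (\<Phi> l j))"
      unfolding exp_add[symmetric] by simp
    also have "exp (\<Sum>j=1..d. - 2 * c j * real (\<Phi> l j)) = (\<Prod>j=1..d. q j ^ \<Phi> l j)"
      by (simp add: exp_sum q_def c_def exp_of_nat_mult[symmetric] mult.commute)
    finally show ?thesis .
  qed
  have "(\<Sum>l\<in>F. exp (2 * B l)) \<le> (\<Sum>l\<in>F. exp (2 * (t 1 / s 1) * L) * (\<Prod>j=1..d. q j ^ \<Phi> l j))"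
    by (intro sum_mono summand)
  also have "\<dots> = exp (2 * (t 1 / s 1) * L) * (\<Sum>m\<in>\<Phi> ` F. \<Prod>j=1..d. q j ^ m j)"
    by (simp add: sum_distrib_left sum.reindex[OF inj])
  also have "\<dots> \<le> exp (2 * (t 1 / s 1) * L) * (\<Prod>j=1..d. 1 / (1 - q j))"
  proof (intro mult_left_mono sum_prod_power_le)
    show "\<Phi> ` F \<subseteq> (\<Pi>\<^sub>E j\<in>{1..d}. UNIV)"
      using d by (auto simp: F_def multi_idx_def \<Phi>_def PiE_iff extensional_def)
    show "q j < 1" if "j \<in> {1..d}" for j
      using c_pos[OF that] by (simp add: q_def c_def)
  qed (auto simp: q_def fin)
  finally show "(\<Sum>l\<in>F. exp (2 * (\<Sum>j=1..d. t j * real (l j)))) \<le> exp (2 * (t 1 / s 1) * L) * (\<Prod>j=1..d. 1 / (1 - q j))"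
    unfolding B_def .
qed

section \<open>Exponential weights: the regimes below and above the rate\<close>

locale exp_weights =
  fixes d :: nat and R :: real and t s :: "nat \<Rightarrow> real" and a b :: "(nat \<Rightarrow> nat) \<Rightarrow> real"
  assumes d: "d \<ge> 1" and R: "R > 0" and t1: "t 1 > 0"
    and t: "\<And>j. j \<in> {2..d} \<Longrightarrow> t j \<ge> 0" and s: "\<And>j. j \<in> {1..d} \<Longrightarrow> s j > 0"
    and b: "\<And>l. l \<in> multi_idx d \<Longrightarrow> b l = (\<Prod>j=1..d. exp (- t j * real (l j)))"
    and a: "\<And>l. l \<in> multi_idx d \<Longrightarrow> a l = (\<Prod>j=1..d. exp (s j * real (l j)))"
    and ts: "\<And>j. j \<in> {2..d} \<Longrightarrow> t 1 / s 1 > t j / s j"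
begin

definition \<kappa> :: real where "\<kappa> = t 1 / s 1"

definition \<rho> :: "real \<Rightarrow> real" where "\<rho> \<epsilon> = \<epsilon> powr (s 1 / (s 1 + t 1))"

text \<open>Position \<open>n\<close> along the first axis. The other coordinates take the value 1,
  the least that a multi-index admits.\<close>

definition spike_idx :: "nat \<Rightarrow> nat \<Rightarrow> nat" where
  "spike_idx n = (\<lambda>j\<in>{1..d}. if j = 1 then n else 1)"

lemma s1: "s 1 > 0" using s[of 1] d by simp

lemma \<kappa>: "\<kappa> > 0" using t1 s1 by (simp add: \<kappa>_def)

lemma \<rho>_pos: "\<epsilon> > 0 \<Longrightarrow> \<rho> \<epsilon> > 0" by (simp add: \<rho>_def)

lemma \<rho>_powr: "\<epsilon> > 0 \<Longrightarrow> \<rho> \<epsilon> powr (1 + \<kappa>) = \<epsilon>"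
proof -
  have "s 1 / (s 1 + t 1) * (1 + \<kappa>) = 1"
  proof -
    have "1 + \<kappa> = (s 1 + t 1) / s 1" using s1 by (simp add: \<kappa>_def add_divide_distrib)
    moreover have "s 1 + t 1 \<noteq> 0" using s1 t1 by simp
    ultimately show ?thesis using s1 by simp
  qed
  then show "\<epsilon> > 0 \<Longrightarrow> \<rho> \<epsilon> powr (1 + \<kappa>) = \<epsilon>"
    by (simp only: \<rho>_def powr_powr powr_one)
qed

lemma \<rho>_lim: "(\<rho> \<longlongrightarrow> 0) (at_right 0)"
proof -
  have "s 1 / (s 1 + t 1) > 0" using s1 t1 by simp
  then have "((\<lambda>\<epsilon>. \<epsilon> powr (s 1 / (s 1 + t 1))) \<longlongrightarrow> 0 powr (s 1 / (s 1 + t 1))) (at_right 0)"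
    by (intro tendsto_powr' tendsto_ident_at tendsto_const) (auto intro: eventually_at_right_less eventually_mono[OF eventually_at_right_less])
  then show ?thesis by (simp add: \<rho>_def[abs_def])
qed

lemma a_eq: "l \<in> multi_idx d \<Longrightarrow> a l = exp (\<Sum>j=1..d. s j * real (l j))"
  by (simp add: a exp_sum)

lemma b_eq: "l \<in> multi_idx d \<Longrightarrow> b l = exp (- (\<Sum>j=1..d. t j * real (l j)))"
  by (simp add: b exp_sum sum_negf[symmetric])

lemma spike_idx_in: "n \<ge> 1 \<Longrightarrow> spike_idx n \<in> multi_idx d"
  by (auto simp: spike_idx_def multi_idx_def)

lemma sum_spike_idx: "(\<Sum>j=1..d. f j * real (spike_idx n j)) = f 1 * real n + (\<Sum>j=2..d. f j)" for f :: "nat \<Rightarrow> real"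
  unfolding sum_split_first[OF d] using d by (auto simp: spike_idx_def intro!: sum.cong)

lemma sum_s_nonneg: "(\<Sum>j=2..d. s j) \<ge> 0"
  using s by (intro sum_nonneg less_imp_le) auto

lemma sum_t_nonneg: "(\<Sum>j=2..d. t j) \<ge> 0"
  using t by (intro sum_nonneg) auto

lemma a_spike_idx: "n \<ge> 1 \<Longrightarrow> a (spike_idx n) = exp (s 1 * real n + (\<Sum>j=2..d. s j))"
  by (simp only: a_eq[OF spike_idx_in] sum_spike_idx)

lemma b_spike_idx: "n \<ge> 1 \<Longrightarrow> b (spike_idx n) = exp (- (t 1 * real n + (\<Sum>j=2..d. t j)))"
  by (simp only: b_eq[OF spike_idx_in] sum_spike_idx)

text \<open>
  The test looks at one coordinate far enough out that \<open>b i * \<theta> i\<close> is negligible there, uniformly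
  over the ellipsoid; it stands in for a randomized test that ignores the data.
\<close>

lemma undetectable_upper:
  assumes \<alpha>: "0 < \<alpha>" "\<alpha> < 1" and \<delta>: "(\<delta> \<longlongrightarrow> 0) (at_right 0)"
  shows "\<forall>\<^sub>F \<epsilon> in at_right 0. minimax_type2_error (multi_idx d) b \<epsilon> (ellipsoid_away (multi_idx d) a R (r \<epsilon>)) (\<alpha> + \<delta> \<epsilon>)
    \<le> ennreal (1 - (\<alpha> + \<delta> \<epsilon>) + (\<epsilon>\<^sup>2 / 2 + \<epsilon>))"
proof -
  have "((\<lambda>\<epsilon>. \<alpha> + \<delta> \<epsilon>) \<longlongrightarrow> \<alpha> + 0) (at_right 0)"
    by (intro tendsto_add tendsto_const \<delta>)
  then have "\<forall>\<^sub>F \<epsilon> in at_right 0. 0 < \<alpha> + \<delta> \<epsilon>" "\<forall>\<^sub>F \<epsilon> in at_right 0. \<alpha> + \<delta> \<epsilon> < 1"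
    using \<alpha> by (auto simp: order_tendsto_iff)
  then show ?thesis using eventually_at_right_less[of "0::real"]
  proof eventually_elim
    case (elim \<epsilon>)
    \<comment> \<open>This choice makes \<open>a i \<ge> R / \<epsilon>\<^sup>2\<close>, because
      \<open>exp x \<ge> x\<close>. The ellipsoid then forces
      \<open>\<bar>\<theta> i\<bar> \<le> \<epsilon>\<^sup>2\<close>, hence a signal-to-noise ratio
      of at most \<open>\<epsilon>\<close>. The successor below keeps the index positive.\<close>
    obtain n where n: "R / \<epsilon>\<^sup>2 / s 1 \<le> real n" using real_arch_simple by blast
    define i where "i = spike_idx (Suc n)"
    have i: "i \<in> multi_idx d" unfolding i_def by (rule spike_idx_in) simp
    have "R / \<epsilon>\<^sup>2 \<le> s 1 * Suc n"
    proof -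
      have "R / \<epsilon>\<^sup>2 \<le> real n * s 1" by (rule iffD1[OF pos_divide_le_eq[OF s1] n])
      also have "\<dots> \<le> s 1 * Suc n" using s1 by simp
      finally show ?thesis .
    qed
    also have "\<dots> \<le> exp (s 1 * Suc n)" using exp_ge_add_one_self[of "s 1 * Suc n"] by linarith
    also have "\<dots> \<le> a i"
      unfolding i_def using sum_s_nonneg a_spike_idx[of "Suc n"] by simp
    finally have ai: "R \<le> a i * \<epsilon>\<^sup>2" using elim(3) by (simp add: field_simps)
    have ai_pos: "a i > 0" by (simp add: a_eq[OF i])
    have "0 \<le> t 1 * real (Suc n) + (\<Sum>j=2..d. t j)"
      using sum_t_nonneg t1 by (intro add_nonneg_nonneg mult_nonneg_nonneg) auto
    then have bi: "0 < b i" "b i \<le> 1"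
      unfolding i_def b_spike_idx[of "Suc n", simplified] by simp_all
    show ?case
    proof (rule minimax_type2_error_le_coordinate[OF i elim(3,1,2)])
      fix \<theta> assume "\<theta> \<in> ellipsoid_away (multi_idx d) a R (r \<epsilon>)"
      then have "\<theta> \<in> ellipsoid (multi_idx d) a R" by (simp add: ellipsoid_away_def)
      from ellipsoid_coordinate_le[OF this i] R have "a i * \<bar>\<theta> i\<bar> \<le> R"
        using ai_pos by (simp add: abs_mult)
      with ai have "\<bar>\<theta> i\<bar> \<le> \<epsilon>\<^sup>2"
        using ai_pos by (meson mult_le_cancel_left_pos order_trans)
      moreover have "b i * \<bar>\<theta> i\<bar> \<le> 1 * \<bar>\<theta> i\<bar>" using bi by (intro mult_right_mono) auto
      ultimately have "\<bar>b i * \<theta> i\<bar> \<le> \<epsilon> * \<epsilon>"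
        using bi by (simp add: abs_mult power2_eq_square)
      then show "\<bar>b i * \<theta> i / \<epsilon>\<bar> \<le> \<epsilon>" using elim(3) by (simp add: field_simps)
    qed
  qed
qed

text \<open>\<open>H\<close> bounds the signal-to-noise ratio of the spike; it comes out as a
  constant times \<open>(r \<epsilon> / \<rho> \<epsilon>) powr (1 + \<kappa>)\<close>.\<close>

lemma undetectable_lower:
  assumes r: "\<And>\<epsilon>. \<epsilon> > 0 \<Longrightarrow> r \<epsilon> > 0" and lim: "((\<lambda>\<epsilon>. r \<epsilon> / \<rho> \<epsilon>) \<longlongrightarrow> 0) (at_right 0)"
  obtains H where "(H \<longlongrightarrow> 0) (at_right 0)"
    "\<forall>\<^sub>F \<epsilon> in at_right 0. ennreal (1 - c \<epsilon> - ((H \<epsilon>)\<^sup>2 / 2 + H \<epsilon>))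
      \<le> minimax_type2_error (multi_idx d) b \<epsilon> (ellipsoid_away (multi_idx d) a R (r \<epsilon>)) (c \<epsilon>)"
proof -
  define S where "S = (\<Sum>j=2..d. s j)"
  \<comment> \<open>In the exponent, \<open>S\<close> stems from the coordinates fixed at 1,
    \<open>s 1\<close> from rounding the spike position down, and \<open>- ln R\<close> from the
    size of the ellipsoid.\<close>
  define K where "K = exp (\<kappa> * (S + s 1 - ln R))"
  define H where "H \<epsilon> = K * (r \<epsilon> / \<rho> \<epsilon>) powr (1 + \<kappa>)" for \<epsilon>
  have pos: "\<forall>\<^sub>F \<epsilon> in at_right 0. (0::real) < \<epsilon>" by (rule eventually_at_right_less)
  have "((\<lambda>\<epsilon>. r \<epsilon> / \<rho> \<epsilon> * \<rho> \<epsilon>) \<longlongrightarrow> 0 * 0) (at_right 0)"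
    by (intro tendsto_mult lim \<rho>_lim)
  moreover have "\<forall>\<^sub>F \<epsilon> in at_right 0. r \<epsilon> / \<rho> \<epsilon> * \<rho> \<epsilon> = r \<epsilon>"
    using pos by eventually_elim (simp add: \<rho>_def)
  ultimately have "(r \<longlongrightarrow> 0 * 0) (at_right 0)" by (rule Lim_transform_eventually)
  then have r_lim: "(r \<longlongrightarrow> 0) (at_right 0)" by simp
  \<comment> \<open>This ensures that the spike position \<open>x\<close> below is at least
    1.\<close>
  have r_small: "\<forall>\<^sub>F \<epsilon> in at_right 0. r \<epsilon> < R / exp (S + s 1)"
    using R by (intro order_tendstoD(2)[OF r_lim]) simp
  have "((\<lambda>\<epsilon>. (r \<epsilon> / \<rho> \<epsilon>) powr (1 + \<kappa>)) \<longlongrightarrow> 0 powr (1 + \<kappa>)) (at_right 0)"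
  proof (rule tendsto_powr'[OF lim tendsto_const])
    have "\<forall>\<^sub>F \<epsilon> in at_right 0. 0 \<le> r \<epsilon> / \<rho> \<epsilon>"
      using pos by eventually_elim (intro divide_nonneg_nonneg less_imp_le[OF r] less_imp_le[OF \<rho>_pos])
    then show "0 \<noteq> (0::real) \<or> 0 < 1 + \<kappa> \<and> (\<forall>\<^sub>F \<epsilon> in at_right 0. 0 \<le> r \<epsilon> / \<rho> \<epsilon>)"
      using \<kappa> by simp
  qed
  then have "((\<lambda>\<epsilon>. K * (r \<epsilon> / \<rho> \<epsilon>) powr (1 + \<kappa>)) \<longlongrightarrow> K * 0) (at_right 0)"
    using \<kappa> by (intro tendsto_mult tendsto_const) simp
  then have "(H \<longlongrightarrow> 0) (at_right 0)" by (simp add: H_def[abs_def])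
  moreover from pos r_small
  have "\<forall>\<^sub>F \<epsilon> in at_right 0. ennreal (1 - c \<epsilon> - ((H \<epsilon>)\<^sup>2 / 2 + H \<epsilon>))
      \<le> minimax_type2_error (multi_idx d) b \<epsilon> (ellipsoid_away (multi_idx d) a R (r \<epsilon>)) (c \<epsilon>)"
  proof eventually_elim
    case (elim \<epsilon>)
    note re = r[OF elim(1)]
    \<comment> \<open>The real solution of \<open>exp (s 1 * x + S) = R / r \<epsilon>\<close>, the
      farthest position that the ellipsoid allows; \<open>n\<close> rounds it down.\<close>
    define x where "x = (ln R - ln (r \<epsilon>) - S) / s 1"
    define n where "n = nat \<lfloor>x\<rfloor>"
    have "exp (S + s 1) * r \<epsilon> < R" using elim(2) by (simp add: field_simps)
    then have "ln (exp (S + s 1) * r \<epsilon>) < ln R" using re R by (subst ln_less_cancel_iff) auto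
    then have "S + s 1 + ln (r \<epsilon>) < ln R" using re by (simp add: ln_mult)
    then have "1 \<le> x" using s1 by (simp add: x_def field_simps)
    then have "real n = of_int \<lfloor>x\<rfloor>" by (simp add: n_def)
    with floor_correct[of x] have n_x: "real n \<le> x" "x \<le> real n + 1" by linarith+
    have n: "n \<ge> 1" using \<open>1 \<le> x\<close> by (simp add: n_def le_nat_floor)
    define i where "i = spike_idx n"
    have i: "i \<in> multi_idx d" unfolding i_def by (rule spike_idx_in[OF n])
    have "s 1 * real n \<le> ln R - ln (r \<epsilon>) - S"
      using n_x(1) s1 by (simp add: x_def field_simps)
    then have "a i \<le> exp (ln R - ln (r \<epsilon>))"
      unfolding i_def a_spike_idx[OF n] S_def by simp
    also have "\<dots> = R / r \<epsilon>" using R re by (simp add: exp_diff)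
    finally have "a i * r \<epsilon> \<le> R" using re by (simp add: field_simps)
    then have "\<bar>a i * r \<epsilon>\<bar> \<le> R" using re by (simp add: a_eq[OF i])
    then have mem: "(\<lambda>l. if l = i then r \<epsilon> else 0) \<in> ellipsoid_away (multi_idx d) a R (r \<epsilon>)"
      using re by (intro ellipsoid_spike[OF i]) auto
    have "ln R - ln (r \<epsilon>) - S \<le> s 1 * (real n + 1)"
      using n_x(2) s1 by (simp add: x_def field_simps)
    then have "\<kappa> * (ln R - ln (r \<epsilon>) - S) \<le> \<kappa> * (s 1 * (real n + 1))"
      using \<kappa> by (intro mult_left_mono) auto
    also have "\<dots> = t 1 * real n + \<kappa> * s 1" using s1 by (simp add: \<kappa>_def field_simps)
    finally have "- (t 1 * real n) \<le> \<kappa> * (S + s 1 - ln R) + \<kappa> * ln (r \<epsilon>)"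
      by (simp add: algebra_simps)
    then have "b i \<le> exp (\<kappa> * (S + s 1 - ln R) + \<kappa> * ln (r \<epsilon>))"
      unfolding i_def b_spike_idx[OF n] using sum_t_nonneg by simp
    also have "\<dots> = K * r \<epsilon> powr \<kappa>" using re by (simp add: K_def exp_add powr_def)
    finally have "b i * r \<epsilon> / \<epsilon> \<le> K * r \<epsilon> powr \<kappa> * r \<epsilon> / \<epsilon>"
      using re elim(1) by (intro divide_right_mono mult_right_mono) auto
    also have "\<dots> = K * (r \<epsilon> powr (1 + \<kappa>) / \<rho> \<epsilon> powr (1 + \<kappa>))"
      unfolding \<rho>_powr[OF elim(1)] using re by (simp add: powr_add)
    also have "\<dots> = H \<epsilon>" using re \<rho>_pos[OF elim(1)] by (simp add: H_def powr_divide)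
    finally have h: "\<bar>b i * r \<epsilon> / \<epsilon>\<bar> \<le> H \<epsilon>"
      using re elim(1) by (simp add: b_eq[OF i])
    from power_mono[OF h abs_ge_zero, of 2] have "(b i * r \<epsilon> / \<epsilon>)\<^sup>2 \<le> (H \<epsilon>)\<^sup>2"
      by (simp only: power2_abs)
    with h have "ennreal (1 - c \<epsilon> - ((H \<epsilon>)\<^sup>2 / 2 + H \<epsilon>)) \<le>
      ennreal (1 - c \<epsilon> - ((b i * r \<epsilon> / \<epsilon>)\<^sup>2 / 2 + \<bar>b i * r \<epsilon> / \<epsilon>\<bar>))"
      by (intro ennreal_leI) linarith
    also have "\<dots> \<le> minimax_type2_error (multi_idx d) b \<epsilon> (ellipsoid_away (multi_idx d) a R (r \<epsilon>)) (c \<epsilon>)"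
      by (rule minimax_type2_error_ge[OF i elim(1) mem])
    finally show ?case .
  qed
  ultimately show ?thesis by (rule that)
qed

lemma undetectable:
  assumes \<alpha>: "0 < \<alpha>" "\<alpha> < 1" and \<delta>: "(\<delta> \<longlongrightarrow> 0) (at_right 0)"
    and r: "\<And>\<epsilon>. \<epsilon> > 0 \<Longrightarrow> r \<epsilon> > 0" and lim: "((\<lambda>\<epsilon>. r \<epsilon> / \<rho> \<epsilon>) \<longlongrightarrow> 0) (at_right 0)"
  shows "((\<lambda>\<epsilon>. minimax_type2_error (multi_idx d) b \<epsilon> (ellipsoid_away (multi_idx d) a R (r \<epsilon>)) (\<alpha> + \<delta> \<epsilon>))
     \<longlongrightarrow> ennreal (1 - \<alpha>)) (at_right 0)"
proof -
  obtain H where H: "(H \<longlongrightarrow> 0) (at_right 0)"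
    and le: "\<forall>\<^sub>F \<epsilon> in at_right 0. ennreal (1 - (\<alpha> + \<delta> \<epsilon>) - ((H \<epsilon>)\<^sup>2 / 2 + H \<epsilon>))
      \<le> minimax_type2_error (multi_idx d) b \<epsilon> (ellipsoid_away (multi_idx d) a R (r \<epsilon>)) (\<alpha> + \<delta> \<epsilon>)"
    using undetectable_lower[OF r lim, where c="\<lambda>\<epsilon>. \<alpha> + \<delta> \<epsilon>"] by blast
  have "((\<lambda>\<epsilon>. 1 - (\<alpha> + \<delta> \<epsilon>) - ((H \<epsilon>)\<^sup>2 / 2 + H \<epsilon>)) \<longlongrightarrow> 1 - (\<alpha> + 0) - (0\<^sup>2 / 2 + 0)) (at_right 0)"
    by (intro tendsto_add tendsto_diff tendsto_divide tendsto_power tendsto_const \<delta> H) simp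
  then have lower: "((\<lambda>\<epsilon>. ennreal (1 - (\<alpha> + \<delta> \<epsilon>) - ((H \<epsilon>)\<^sup>2 / 2 + H \<epsilon>))) \<longlongrightarrow> ennreal (1 - \<alpha>)) (at_right 0)"
    by (intro tendsto_ennrealI) simp
  have "((\<lambda>\<epsilon>. 1 - (\<alpha> + \<delta> \<epsilon>) + (\<epsilon>\<^sup>2 / 2 + \<epsilon>)) \<longlongrightarrow> 1 - (\<alpha> + 0) + (0\<^sup>2 / 2 + 0)) (at_right 0)"
    by (intro tendsto_add tendsto_diff tendsto_divide tendsto_power tendsto_const tendsto_ident_at \<delta>) simp
  then have upper: "((\<lambda>\<epsilon>. ennreal (1 - (\<alpha> + \<delta> \<epsilon>) + (\<epsilon>\<^sup>2 / 2 + \<epsilon>))) \<longlongrightarrow> ennreal (1 - \<alpha>)) (at_right 0)"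
    by (intro tendsto_ennrealI) simp
  show ?thesis
    by (rule tendsto_sandwich[OF le undetectable_upper[OF \<alpha> \<delta>] lower upper])
qed

lemma detectable:
  assumes \<alpha>: "0 < \<alpha>" and \<delta>: "(\<delta> \<longlongrightarrow> 0) (at_right 0)"
    and r: "\<And>\<epsilon>. \<epsilon> > 0 \<Longrightarrow> r \<epsilon> > 0" and lim: "filterlim (\<lambda>\<epsilon>. r \<epsilon> / \<rho> \<epsilon>) at_top (at_right 0)"
  shows "((\<lambda>\<epsilon>. minimax_type2_error (multi_idx d) b \<epsilon> (ellipsoid_away (multi_idx d) a R (r \<epsilon>)) (\<alpha> + \<delta> \<epsilon>))
     \<longlongrightarrow> 0) (at_right 0)"
proof -
  let ?A = "\<lambda>l. \<Sum>j=1..d. s j * real (l j)" and ?B = "\<lambda>l. \<Sum>j=1..d. t j * real (l j)"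
  define C where "C = (\<Prod>j=1..d. 1 / (1 - exp (- 2 * (if j = 1 then t 1 else t 1 / s 1 * s j - t j))))"
  define F where "F L = {l \<in> multi_idx d. ?A l \<le> L}" for L
  have fin: "finite (F L)" for L
    unfolding F_def by (rule exp_weights_count(1)[of d s t, OF d s t1 ts])
  have count: "(\<Sum>l\<in>F L. exp (2 * ?B l)) \<le> exp (2 * \<kappa> * L) * C" for L
    unfolding F_def C_def \<kappa>_def by (rule exp_weights_count(2)[of d s t, OF d s t1 ts])
  \<comment> \<open>Collects the factor 8 from Markov's inequality at \<open>r\<^sup>2 / 8\<close>,
    the product of geometric series, and the numerator of
    \<open>M powr (2 * \<kappa>)\<close>.\<close>
  define K where "K = 8 * C * (2 * R) powr (2 * \<kappa>)"
  define E where "E \<epsilon> = K * (r \<epsilon> / \<rho> \<epsilon>) powr (- (2 + 2 * \<kappa>))" for \<epsilon>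
  have pos: "\<forall>\<^sub>F \<epsilon> in at_right 0. (0::real) < \<epsilon>" by (rule eventually_at_right_less)
  have "((\<lambda>\<epsilon>. K * (r \<epsilon> / \<rho> \<epsilon>) powr (- (2 + 2 * \<kappa>))) \<longlongrightarrow> K * 0) (at_right 0)"
    using \<kappa> by (intro tendsto_mult tendsto_const tendsto_neg_powr lim) auto
  then have E: "(E \<longlongrightarrow> 0) (at_right 0)" by (simp add: E_def[abs_def])
  have "((\<lambda>\<epsilon>. \<alpha> + \<delta> \<epsilon> - E \<epsilon>) \<longlongrightarrow> \<alpha> + 0 - 0) (at_right 0)"
    by (intro tendsto_add tendsto_diff tendsto_const \<delta> E)
  \<comment> \<open>Once \<open>E \<epsilon>\<close> is below
    \<open>\<alpha> + \<delta> \<epsilon>\<close>, the energy test has the required level.\<close>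
  then have "\<forall>\<^sub>F \<epsilon> in at_right 0. 0 < \<alpha> + \<delta> \<epsilon> - E \<epsilon>"
    using \<alpha> by (intro order_tendstoD(1)) auto
  with pos have "\<forall>\<^sub>F \<epsilon> in at_right 0. minimax_type2_error (multi_idx d) b \<epsilon>
      (ellipsoid_away (multi_idx d) a R (r \<epsilon>)) (\<alpha> + \<delta> \<epsilon>) \<le> ennreal (E \<epsilon>)"
  proof eventually_elim
    case (elim \<epsilon>)
    note re = r[OF elim(1)]
    define M where "M = 2 * R / r \<epsilon>"
    have M: "M > 0" using R re by (simp add: M_def)
    let ?F = "F (ln M)"
    have sub: "?F \<subseteq> multi_idx d" by (auto simp: F_def)
    have "(\<Sum>l\<in>?F. (\<epsilon> / b l)\<^sup>2) = (\<Sum>l\<in>?F. \<epsilon>\<^sup>2 * exp (2 * ?B l))"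
    proof (rule sum.cong[OF refl])
      fix l assume "l \<in> ?F"
      then have "b l = exp (- ?B l)" using sub b_eq by blast
      then show "(\<epsilon> / b l)\<^sup>2 = \<epsilon>\<^sup>2 * exp (2 * ?B l)"
        by (simp only: exp_minus divide_inverse inverse_inverse_eq power_mult_distrib exp_double)
    qed
    also have "\<dots> \<le> \<epsilon>\<^sup>2 * (exp (2 * \<kappa> * ln M) * C)"
      unfolding sum_distrib_left[symmetric] by (rule mult_left_mono[OF count zero_le_power2])
    also have "exp (2 * \<kappa> * ln M) = (2 * R) powr (2 * \<kappa>) * r \<epsilon> powr (- 2 * \<kappa>)"
    proof -
      have "exp (2 * \<kappa> * ln M) = M powr (2 * \<kappa>)" using M by (simp add: powr_def)
      also have "\<dots> = (2 * R) powr (2 * \<kappa>) / r \<epsilon> powr (2 * \<kappa>)"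
        unfolding M_def by (rule powr_divide)
      finally show ?thesis by (simp add: powr_minus divide_inverse)
    qed
    finally have "8 * (\<Sum>l\<in>?F. (\<epsilon> / b l)\<^sup>2) / (r \<epsilon>)\<^sup>2 \<le>
      8 * (\<epsilon>\<^sup>2 * ((2 * R) powr (2 * \<kappa>) * r \<epsilon> powr (- 2 * \<kappa>) * C)) / (r \<epsilon>)\<^sup>2"
      by (intro divide_right_mono mult_left_mono) auto
    also have "\<dots> = K * (\<epsilon>\<^sup>2 * (r \<epsilon> powr (- 2 * \<kappa>) / (r \<epsilon>)\<^sup>2))"
      by (simp add: K_def)
    \<comment> \<open>Writing \<open>\<epsilon>\<close> as
      \<open>\<rho> \<epsilon> powr (1 + \<kappa>)\<close> leaves a power of the ratio of
      \<open>r\<close> to the rate.\<close>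
    also have "\<epsilon>\<^sup>2 * (r \<epsilon> powr (- 2 * \<kappa>) / (r \<epsilon>)\<^sup>2) = (r \<epsilon> / \<rho> \<epsilon>) powr (- (2 + 2 * \<kappa>))"
    proof -
      have "\<epsilon>\<^sup>2 = (\<rho> \<epsilon> powr (1 + \<kappa>)) powr 2"
        using \<rho>_powr[OF elim(1)] elim(1) by (simp add: powr_numeral)
      also have "\<dots> = \<rho> \<epsilon> powr (2 + 2 * \<kappa>)" by (simp add: powr_powr algebra_simps)
      finally have "\<epsilon>\<^sup>2 = \<rho> \<epsilon> powr (2 + 2 * \<kappa>)" .
      moreover have "r \<epsilon> powr (- 2 * \<kappa>) / (r \<epsilon>)\<^sup>2 = r \<epsilon> powr (- (2 + 2 * \<kappa>))"
      proof -
        have "r \<epsilon> powr (- 2 * \<kappa> - 2) = r \<epsilon> powr (- 2 * \<kappa>) / r \<epsilon> powr 2" by (rule powr_diff)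
        moreover have "r \<epsilon> powr 2 = (r \<epsilon>)\<^sup>2" using re by simp
        moreover have "- 2 * \<kappa> - 2 = - (2 + 2 * \<kappa>)" by simp
        ultimately show ?thesis by (simp only:)
      qed
      moreover have "(r \<epsilon> / \<rho> \<epsilon>) powr (- (2 + 2 * \<kappa>)) = r \<epsilon> powr (- (2 + 2 * \<kappa>)) / \<rho> \<epsilon> powr (- (2 + 2 * \<kappa>))"
        by (rule powr_divide)
      ultimately show ?thesis
        by (simp only: powr_minus[of "\<rho> \<epsilon>"] divide_inverse inverse_inverse_eq mult.commute)
    qed
    finally have V: "8 * (\<Sum>l\<in>?F. (\<epsilon> / b l)\<^sup>2) / (r \<epsilon>)\<^sup>2 \<le> E \<epsilon>" by (simp add: E_def)
    have "minimax_type2_error (multi_idx d) b \<epsilon> (ellipsoid_away (multi_idx d) a R (r \<epsilon>)) (\<alpha> + \<delta> \<epsilon>)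
      \<le> ennreal (8 * (\<Sum>l\<in>?F. (\<epsilon> / b l)\<^sup>2) / (r \<epsilon>)\<^sup>2)"
    proof (rule minimax_type2_error_le_energy[OF fin sub _ elim(1) re])
      show "b l \<noteq> 0" if "l \<in> ?F" for l
        using sub that b_eq[of l] by auto
      show "8 * (\<Sum>l\<in>?F. (\<epsilon> / b l)\<^sup>2) / (r \<epsilon>)\<^sup>2 \<le> \<alpha> + \<delta> \<epsilon>"
        using V elim(2) by linarith
      fix \<theta> assume \<theta>: "\<theta> \<in> ellipsoid_away (multi_idx d) a R (r \<epsilon>)"
      show "(r \<epsilon>)\<^sup>2 / 2 \<le> (\<Sum>l\<in>?F. (\<theta> l)\<^sup>2)"
      proof (rule ellipsoid_away_energy[OF \<theta> re M _ fin sub])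
        show "2 * R\<^sup>2 \<le> (M * r \<epsilon>)\<^sup>2" using re by (simp add: M_def power_mult_distrib)
        fix l assume l: "l \<in> multi_idx d - ?F"
        then have "ln M \<le> ?A l" by (auto simp: F_def)
        then have "exp (ln M) \<le> exp (?A l)" by simp
        then show "M \<le> \<bar>a l\<bar>" using M l by (simp add: a_eq)
      qed
    qed
    also have "\<dots> \<le> ennreal (E \<epsilon>)" using V by (rule ennreal_leI)
    finally show ?case .
  qed
  then show ?thesis
  proof (rule tendsto_sandwich[OF _ _ tendsto_const, rotated])
    show "((\<lambda>\<epsilon>. ennreal (E \<epsilon>)) \<longlongrightarrow> 0) (at_right 0)"
      using tendsto_ennrealI[OF E] by simp
  qed simp
qed

lemma separation_rate:
  assumes "0 < \<alpha>" "\<alpha> < 1" "(\<delta> \<longlongrightarrow> 0) (at_right 0)"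
  shows "minimax_separation_rate (multi_idx d) b a R \<alpha> \<delta> \<rho>"
  using assms undetectable detectable \<rho>_pos unfolding minimax_separation_rate_def by blast

end

section \<open>The separation rate for exponential weights\<close>

theorem proposition3:
  fixes d :: nat and R \<alpha> :: real and t s :: "nat \<Rightarrow> real"
    and a b :: "(nat \<Rightarrow> nat) \<Rightarrow> real" and \<delta> :: "real \<Rightarrow> real"
  assumes "d \<ge> 1" and "R > 0" and "0 < \<alpha>" and "\<alpha> < 1"
    and "t 1 > 0" and "\<And>j. j \<in> {2..d} \<Longrightarrow> t j \<ge> 0" and "\<And>j. j \<in> {1..d} \<Longrightarrow> s j > 0"
    and "\<And>l. l \<in> multi_idx d \<Longrightarrow> b l = (\<Prod>j=1..d. exp (- t j * real (l j)))"
    and "\<And>l. l \<in> multi_idx d \<Longrightarrow> a l = (\<Prod>j=1..d. exp (s j * real (l j)))"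
    and "\<And>j. j \<in> {2..d} \<Longrightarrow> t 1 / s 1 > t j / s j"
    and "(\<delta> \<longlongrightarrow> 0) (at_right 0)"
  shows "minimax_separation_rate (multi_idx d) b a R \<alpha> \<delta> (\<lambda>\<epsilon>. \<epsilon> powr (s 1 / (s 1 + t 1))) \<and>
    (\<forall>rstar. minimax_separation_rate (multi_idx d) b a R \<alpha> \<delta> rstar \<longrightarrow>
       asymp_comparable rstar (\<lambda>\<epsilon>. \<epsilon> powr (s 1 / (s 1 + t 1))))"
proof -
  interpret W: exp_weights d R t s a b
    by (rule exp_weights.intro) (fact assms)+
  let ?w = "\<lambda>\<epsilon>. \<epsilon> powr (s 1 / (s 1 + t 1))"
  have rate: "minimax_separation_rate (multi_idx d) b a R \<alpha> \<delta> ?w"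
    using W.separation_rate[OF assms(3,4,11)] unfolding W.\<rho>_def[abs_def] .
  moreover have "asymp_comparable v ?w" if v: "minimax_separation_rate (multi_idx d) b a R \<alpha> \<delta> v" for v
  proof -
    \<comment> \<open>Each rate dominates the other; inverting the second comparison gives the upper
      constant \<open>1 / k'\<close>.\<close>
    obtain k where k: "k > 0" "\<forall>\<^sub>F \<epsilon> in at_right 0. k * ?w \<epsilon> \<le> v \<epsilon>"
      using separation_rate_dominates[OF v rate assms(4)] by auto
    obtain k' where k': "k' > 0" "\<forall>\<^sub>F \<epsilon> in at_right 0. k' * v \<epsilon> \<le> ?w \<epsilon>"
      using separation_rate_dominates[OF rate v assms(4)] by auto
    have "\<forall>\<^sub>F \<epsilon> in at_right 0. k * ?w \<epsilon> \<le> v \<epsilon> \<and> v \<epsilon> \<le> 1 / k' * ?w \<epsilon>"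
      using k(2) k'(2) by eventually_elim (use k'(1) in \<open>simp add: field_simps\<close>)
    moreover have "1 / k' > 0" using k'(1) by simp
    ultimately show ?thesis unfolding asymp_comparable_def using k(1) by blast
  qed
  ultimately show ?thesis by blast
qed

end
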